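(* Let $\Gamma\subset\mathbb{C}$ be a lattice and let $\mu\in\mathbb{R}\setminus\{0\}$. A solution $\lambda=\lambda_1+\mathbf{j}\lambda_2:\mathbb{C}\to\mathbb{H}$ of the system $$2\mathbf{i}\,\partial\lambda_1=\mu\lambda_2,\qquad 2\mathbf{i}\,\bar\partial\lambda_2=\mu\lambda_1$$ such that the $1$-form $df=\bar\lambda\,\mathbf{j}\,dz\,\lambda$ is doubly periodic with respect to $\Gamma$ is given by $$\lambda_1=\sum_{\omega\in\Gamma'}a_\omega\,e^{\mathbf{i}\langle\omega+\omega_0,z\rangle},\qquad \lambda_2=-\sum_{\omega\in\Gamma'}\tfrac{1}{\mu}\,a_\omega\,(\bar\omega+\bar\omega_0)\,e^{\mathbf{i}\langle\omega+\omega_0,z\rangle},$$ where $\omega_0\in\tfrac12\Gamma^*$, $a_\omega\in\mathbb{C}$, and $\Gamma'\subset\Gamma^*$ is the set of dual lattice vectors $\omega$ with $|\omega+\omega_0|^2=\mu^2$.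
   Context: $\mathbb{H}$ denotes the quaternions with units $\mathbf{i},\mathbf{j},\mathbf{k}$, $\mathbb{C}=\operatorname{span}_{\mathbb{R}}(1,\mathbf{i})\subset\mathbb{H}$, and every $\lambda\in\mathbb{H}$ is written uniquely as $\lambda=\lambda_1+\mathbf{j}\lambda_2$ with $\lambda_1,\lambda_2\in\mathbb{C}$; $\bar\lambda$ is the quaternionic conjugate. Here $z$ is the standard coordinate on $\mathbb{C}$, $\partial=\frac{\partial}{\partial z}$, $\bar\partial=\frac{\partial}{\partial\bar z}$, and $\langle w,z\rangle=\operatorname{Re}(w\bar z)$ is the standard Euclidean inner product on $\mathbb{C}\cong\mathbb{R}^2$. The dual lattice of $\Gamma$ is $\Gamma^*=\{\omega\in\mathbb{C}:\langle\omega,\gamma\rangle\in2\pi\mathbb{Z}\text{ for all }\gamma\in\Gamma\}$. The symbol $df$ denotes the $1$-form $\bar\lambda\,\mathbf{j}\,dz\,\lambda$; doubly periodic means that it is invariant under all translations by elements of $\Gamma$, i.e. it is defined on the torus $\mathbb{C}/\Gamma$. *)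

theory Defs
  imports "HOL-Analysis.Analysis"
begin

section \<open>Quaternions\<close>

datatype quat = Quat (qRe: real) (qIm1: real) (qIm2: real) (qIm3: real)

instantiation quat :: ring_1
begin

definition "0 = Quat 0 0 0 0"

definition "1 = Quat 1 0 0 0"

definition "p + q = Quat (qRe p + qRe q) (qIm1 p + qIm1 q) (qIm2 p + qIm2 q) (qIm3 p + qIm3 q)"

definition "- p = Quat (- qRe p) (- qIm1 p) (- qIm2 p) (- qIm3 p)"

definition "p - q = Quat (qRe p - qRe q) (qIm1 p - qIm1 q) (qIm2 p - qIm2 q) (qIm3 p - qIm3 q)"

definition "p * q = Quat
  (qRe p * qRe q - qIm1 p * qIm1 q - qIm2 p * qIm2 q - qIm3 p * qIm3 q)
  (qRe p * qIm1 q + qIm1 p * qRe q + qIm2 p * qIm3 q - qIm3 p * qIm2 q)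
  (qRe p * qIm2 q - qIm1 p * qIm3 q + qIm2 p * qRe q + qIm3 p * qIm1 q)
  (qRe p * qIm3 q + qIm1 p * qIm2 q - qIm2 p * qIm1 q + qIm3 p * qRe q)"

instance
  by standard
    (simp_all add: zero_quat_def one_quat_def plus_quat_def uminus_quat_def minus_quat_def
      times_quat_def algebra_simps)

end

definition quat_i :: quat where "quat_i = Quat 0 1 0 0"

definition quat_j :: quat where "quat_j = Quat 0 0 1 0"

definition quat_k :: quat where "quat_k = Quat 0 0 0 1"

definition quat_cnj :: "quat \<Rightarrow> quat" where
  "quat_cnj q = Quat (qRe q) (- qIm1 q) (- qIm2 q) (- qIm3 q)"

definition quat_of_complex :: "complex \<Rightarrow> quat" where
  "quat_of_complex z = Quat (Re z) (Im z) 0 0"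

lemmas quat_defs = zero_quat_def one_quat_def plus_quat_def uminus_quat_def minus_quat_def
  times_quat_def quat_i_def quat_j_def quat_k_def quat_cnj_def quat_of_complex_def

lemma quat_unit_mult:
  "quat_i * quat_i = - 1" "quat_j * quat_j = - 1" "quat_k * quat_k = - 1"
  "quat_i * quat_j = quat_k" "quat_j * quat_k = quat_i" "quat_k * quat_i = quat_j"
  "quat_j * quat_i = - quat_k" "quat_k * quat_j = - quat_i" "quat_i * quat_k = - quat_j"
  by (simp_all add: quat_defs)

lemma quat_of_complex_hom:
  "quat_of_complex 0 = 0" "quat_of_complex 1 = 1" "quat_of_complex \<i> = quat_i"
  "quat_of_complex (w + z) = quat_of_complex w + quat_of_complex z"
  "quat_of_complex (w * z) = quat_of_complex w * quat_of_complex z"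
  by (simp_all add: quat_defs)

lemma quat_decomposition:
  "\<exists>!(w, z). q = quat_of_complex w + quat_j * quat_of_complex z"
proof (rule ex1I[of _ "(Complex (qRe q) (qIm1 q), Complex (qIm2 q) (- qIm3 q))"])
  show "case (Complex (qRe q) (qIm1 q), Complex (qIm2 q) (- qIm3 q)) of
      (w, z) \<Rightarrow> q = quat_of_complex w + quat_j * quat_of_complex z"
    by (cases q) (simp add: quat_defs)
qed (auto simp: quat_defs complex_eq_iff)


section \<open>Lattices in the plane\<close>

definition is_lattice :: "complex set \<Rightarrow> bool" where
  "is_lattice \<Gamma> \<longleftrightarrow> (\<exists>\<gamma>\<^sub>1 \<gamma>\<^sub>2. \<gamma>\<^sub>1 \<noteq> \<gamma>\<^sub>2 \<and> independent {\<gamma>\<^sub>1, \<gamma>\<^sub>2} \<and>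
     \<Gamma> = {of_int m * \<gamma>\<^sub>1 + of_int n * \<gamma>\<^sub>2 | m n. True})"

definition dual_lattice :: "complex set \<Rightarrow> complex set" where
  "dual_lattice \<Gamma> = {\<omega>. \<forall>\<gamma>\<in>\<Gamma>. \<exists>n::int. inner \<omega> \<gamma> = 2 * pi * of_int n}"

lemma inner_complex_eq_Re: "inner w z = Re (w * cnj z)" for w z :: complex
  by (simp add: inner_complex_def)

definition dual_lattice_circle :: "complex set \<Rightarrow> complex \<Rightarrow> real \<Rightarrow> complex set" where
  "dual_lattice_circle \<Gamma> \<omega>\<^sub>0 \<mu> = {\<omega> \<in> dual_lattice \<Gamma>. (cmod (\<omega> + \<omega>\<^sub>0))\<^sup>2 = \<mu>\<^sup>2}"

text \<open>
  A finite sum over an infinite set would be zero by convention; the next lemma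
  shows that the sums over the sets just defined are genuine.
\<close>

lemma finite_dual_lattice_circle:
  assumes "is_lattice \<Gamma>"
  shows "finite (dual_lattice_circle \<Gamma> \<omega>\<^sub>0 \<mu>)"
proof -
  obtain g h where gh: "g \<noteq> h" "independent {g, h}"
    and \<Gamma>: "\<Gamma> = {of_int m * g + of_int n * h | m n. True}"
    using assms unfolding is_lattice_def by blast
  have "g = of_int 1 * g + of_int 0 * h" "h = of_int 0 * g + of_int 1 * h"
    by simp_all
  then have mem: "g \<in> \<Gamma>" "h \<in> \<Gamma>"
    unfolding \<Gamma> by blast+
  have "dim {g, h} = DIM(complex)"
    using gh by (simp add: dim_eq_card_independent)
  then have span: "span {g, h} = UNIV"
    using dim_eq_full by blast
  define C where "C = dual_lattice_circle \<Gamma> \<omega>\<^sub>0 \<mu>"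
  define f where "f = (\<lambda>\<omega>::complex. (inner \<omega> g / (2 * pi), inner \<omega> h / (2 * pi)))"
  define R where "R = \<bar>\<mu>\<bar> + cmod \<omega>\<^sub>0"
  define B where "B = R * (cmod g + cmod h) / (2 * pi)"
  define S where "S = {x::real. x \<in> \<int> \<and> \<bar>x\<bar> \<le> B}"
  have bound: "\<bar>inner \<omega> v / (2 * pi)\<bar> \<le> B" if "\<omega> \<in> C" "v \<in> {g, h}" for \<omega> v
  proof -
    have "cmod (\<omega> + \<omega>\<^sub>0) = \<bar>\<mu>\<bar>"
      using that(1) power2_eq_iff_nonneg[of "cmod (\<omega> + \<omega>\<^sub>0)" "\<bar>\<mu>\<bar>"]
      by (simp add: C_def dual_lattice_circle_def)
    then have "cmod \<omega> \<le> R"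
      unfolding R_def using norm_triangle_ineq4[of "\<omega> + \<omega>\<^sub>0" \<omega>\<^sub>0] by simp
    moreover have "cmod v \<le> cmod g + cmod h"
      using that(2) by auto
    ultimately have "cmod \<omega> * cmod v \<le> R * (cmod g + cmod h)"
      by (meson mult_mono norm_ge_zero order_trans)
    then have "\<bar>inner \<omega> v\<bar> \<le> R * (cmod g + cmod h)"
      using Cauchy_Schwarz_ineq2[of \<omega> v] by linarith
    then show ?thesis
      unfolding B_def by (simp add: divide_right_mono abs_mult)
  qed
  have int: "inner \<omega> v / (2 * pi) \<in> \<int>" if asm: "\<omega> \<in> C" "v \<in> \<Gamma>" for \<omega> v
  proof -
    obtain n :: int where "inner \<omega> v = 2 * pi * of_int n"
      using asm unfolding C_def dual_lattice_circle_def dual_lattice_def by blast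
    then show ?thesis by simp
  qed
  have "f ` C \<subseteq> S \<times> S"
  proof (rule image_subsetI)
    fix \<omega> assume "\<omega> \<in> C"
    then show "f \<omega> \<in> S \<times> S"
      unfolding f_def S_def using bound int mem by blast
  qed
  moreover have "finite S"
    unfolding S_def by (rule finite_abs_int_segment)
  moreover have "inj_on f C"
  proof (rule inj_onI)
    fix x y assume "f x = f y"
    then have eq: "inner (x - y) g = 0" "inner (x - y) h = 0"
      by (simp_all add: f_def inner_diff_left)
    have "subspace {v. inner (x - y) v = 0}"
      by (rule subspace_hyperplane)
    moreover have "{g, h} \<subseteq> {v. inner (x - y) v = 0}"
      using eq by simp
    ultimately have "span {g, h} \<subseteq> {v. inner (x - y) v = 0}"
      by (rule span_minimal[rotated])
    then have "inner (x - y) (x - y) = 0"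
      using span by blast
    then show "x = y" by simp
  qed
  ultimately show ?thesis
    unfolding C_def[symmetric] by (meson finite_SigmaI finite_imageD finite_subset)
qed


section \<open>Wirtinger derivatives and the first-order system\<close>

definition d_z :: "(complex \<Rightarrow> complex) \<Rightarrow> complex \<Rightarrow> complex" where
  "d_z f z = (frechet_derivative f (at z) 1 - \<i> * frechet_derivative f (at z) \<i>) / 2"

definition d_zbar :: "(complex \<Rightarrow> complex) \<Rightarrow> complex \<Rightarrow> complex" where
  "d_zbar f z = (frechet_derivative f (at z) 1 + \<i> * frechet_derivative f (at z) \<i>) / 2"

definition C1_fun :: "(complex \<Rightarrow> complex) \<Rightarrow> bool" where
  "C1_fun f \<longleftrightarrow> (\<exists>f' :: complex \<Rightarrow> complex \<Rightarrow>\<^sub>L complex.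
     (\<forall>z. (f has_derivative blinfun_apply (f' z)) (at z)) \<and> continuous_on UNIV f')"

text \<open>Solutions are classical: continuously (real) differentiable, no holomorphy assumed.\<close>

definition solves_system ::
  "real \<Rightarrow> (complex \<Rightarrow> complex) \<Rightarrow> (complex \<Rightarrow> complex) \<Rightarrow> bool" where
  "solves_system \<mu> lam\<^sub>1 lam\<^sub>2 \<longleftrightarrow> C1_fun lam\<^sub>1 \<and> C1_fun lam\<^sub>2 \<and>
     (\<forall>z. 2 * \<i> * d_z lam\<^sub>1 z = of_real \<mu> * lam\<^sub>2 z \<and>
          2 * \<i> * d_zbar lam\<^sub>2 z = of_real \<mu> * lam\<^sub>1 z)"


section \<open>Quaternion-valued one-forms\<close>

text \<open>
  A one-form maps a point and a tangent vector to a quaternion; \<open>dz\<close> is the identity on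
  tangent vectors. Translations have identity differential, so the pullback of \<open>\<alpha>\<close> under
  translation by \<open>\<gamma>\<close> is \<open>\<lambda>z v. \<alpha> (z + \<gamma>) v\<close>.
\<close>

definition df_form :: "(complex \<Rightarrow> quat) \<Rightarrow> complex \<Rightarrow> complex \<Rightarrow> quat" where
  "df_form lam z v = quat_cnj (lam z) * quat_j * quat_of_complex v * lam z"

definition doubly_periodic_form :: "complex set \<Rightarrow> (complex \<Rightarrow> complex \<Rightarrow> quat) \<Rightarrow> bool" where
  "doubly_periodic_form \<Gamma> \<alpha> \<longleftrightarrow> (\<forall>\<gamma>\<in>\<Gamma>. \<forall>z v. \<alpha> (z + \<gamma>) v = \<alpha> z v)"

end

theory Submission
  imports Defs
begin

text \<open>
  Periodicity of \<open>df\<close> forces \<open>\<lambda>(z + \<gamma>) = \<plusminus>\<lambda>(z)\<close> at each point \<open>z\<close>. The sign is independent of \<open>z\<close> by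
  unique continuation: a solution vanishing on a ball vanishes identically, because in polar
  coordinates its angular Fourier coefficients solve a linear ordinary differential equation in
  the radius. The signs are thus a character \<open>\<gamma> \<mapsto> exp (\<i> \<langle>\<omega>\<^sub>0, \<gamma>\<rangle>)\<close> of the lattice with
  \<open>\<omega>\<^sub>0 \<in> \<onehalf>\<Gamma>\<^sup>*\<close>. On the Fourier coefficients \<open>U, V\<close> of \<open>\<lambda>\<^sub>1, \<lambda>\<^sub>2\<close> at frequency \<open>\<xi> = \<omega> + \<omega>\<^sub>0\<close> the
  system becomes \<open>cnj \<xi> U = -\<mu> V\<close>, \<open>\<xi> V = -\<mu> U\<close>, whence \<open>|\<xi>|\<^sup>2 U = \<mu>\<^sup>2 U\<close>. So the solution and the
  exponential sum built from its coefficients with \<open>|\<xi>|\<^sup>2 = \<mu>\<^sup>2\<close> have the same Fourier coefficients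
  and coincide.
\<close>

section \<open>Uniqueness of Fourier coefficients\<close>

lemma periodic_int:
  fixes f :: "real \<Rightarrow> 'a"
  assumes "\<And>x. f (x + p) = f x"
  shows "f (x + of_int n * p) = f x"
proof (induction n rule: int_induct[where k = 0])
  case (step1 i)
  then show ?case using assms[of "x + of_int i * p"] by (simp add: algebra_simps)
next
  case (step2 i)
  then show ?case using assms[of "x + of_int (i - 1) * p"] by (simp add: algebra_simps)
qed simp

text \<open>Points with the same \<open>cis\<close> differ by a multiple of 2 pi, so a periodic
  function factors through the unit circle.\<close>

lemma periodic_cis_cong:
  fixes f :: "real \<Rightarrow> 'a"
  assumes "\<And>x. f (x + 2 * pi) = f x" "cis x = cis y"
  shows "f x = f y"
proof -
  from assms(2) have "exp (\<i> * of_real x) = exp (\<i> * of_real y)" by (simp add: cis_conv_exp)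
  then obtain n :: int where "\<i> * of_real x = \<i> * of_real y + (of_int (2 * n) * pi) * \<i>"
    unfolding exp_eq by auto
  then have "x = y + of_int n * (2 * pi)"
    by (simp add: complex_eq_iff algebra_simps)
  with periodic_int[of f "2 * pi" y n, OF assms(1)] show ?thesis by simp
qed

text \<open>\<open>Arg2pi\<close> is discontinuous on the nonnegative real axis only. Near the point
  1 it is replaced by \<open>Arg\<close>, which is continuous there; the two arguments differ by a
  multiple of 2 pi, which \<open>f\<close> does not see.\<close>

lemma continuous_on_circle_of_periodic:
  fixes f :: "real \<Rightarrow> 'a::t2_space"
  assumes "continuous_on UNIV f" "\<And>x. f (x + 2 * pi) = f x"
  shows "continuous_on (sphere 0 1) (\<lambda>z. f (Arg2pi z))"
proof -
  have f: "isCont f x" for x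
    using assms(1) by (simp add: continuous_on_eq_continuous_at)
  have "isCont (\<lambda>z. f (Arg2pi z)) z" if "cmod z = 1" for z
  proof (cases "z \<in> \<real>\<^sub>\<ge>\<^sub>0")
    case False
    then show ?thesis
      using continuous_at_Arg2pi f by (metis continuous_at_compose[unfolded o_def])
  next
    case True
    then have "z \<notin> \<real>\<^sub>\<le>\<^sub>0"
      using that by (auto simp: complex_nonneg_Reals_iff complex_nonpos_Reals_iff complex_eq_iff norm_complex_def)
    then have "isCont (\<lambda>z. f (Arg z)) z"
      using continuous_at_Arg f by (metis continuous_at_compose[unfolded o_def])
    moreover have "f (Arg w) = f (Arg2pi w)" if "w \<noteq> 0" for w
    proof (rule periodic_cis_cong[of f])
      have "of_real (cmod w) * cis (Arg w) = w" "of_real (cmod w) * cis (Arg2pi w) = w"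
        using Arg_eq[OF that] Arg2pi_eq[of w] by (simp_all add: cis_conv_exp)
      then show "cis (Arg w) = cis (Arg2pi w)" using that
        by (metis mult_cancel_left norm_eq_zero of_real_eq_0_iff)
    qed (use assms in auto)
    moreover have "\<forall>\<^sub>F w in nhds z. w \<noteq> 0"
      using that by (intro t1_space_nhds) auto
    ultimately show ?thesis
      by (subst isCont_cong[where g = "\<lambda>z. f (Arg z)"]) (auto elim: eventually_mono)
  qed
  then show ?thesis by (auto intro!: continuous_at_imp_continuous_on)
qed

text \<open>Continuity is bundled in so that the closure properties below carry no integrability
  side conditions. As \<open>n\<close> runs over all integers, the sign in the exponent is
  immaterial.\<close>

definition fourier_null :: "(real \<Rightarrow> complex) \<Rightarrow> bool" where
  "fourier_null f \<longleftrightarrow> continuous_on UNIV f \<and>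
     (\<forall>n::int. integral {0..2 * pi} (\<lambda>x. f x * cis (of_int n * x)) = 0)"

lemma integrable_times_cis:
  assumes "continuous_on UNIV f"
  shows "(\<lambda>x. f x * cis (of_int n * x)) integrable_on {a..b::real}"
  by (intro integrable_continuous_real continuous_intros continuous_on_subset[OF assms]) auto

lemma fourier_null_add:
  assumes "fourier_null f" "fourier_null g"
  shows "fourier_null (\<lambda>x. f x + g x)"
  using assms unfolding fourier_null_def
  by (auto simp: distrib_right integral_add[OF integrable_times_cis integrable_times_cis]
      intro!: continuous_intros)

lemma fourier_null_cmult:
  assumes "fourier_null f"
  shows "fourier_null (\<lambda>x. c * f x)"
  using assms unfolding fourier_null_def
  by (auto simp: mult.assoc intro!: continuous_intros)

lemma fourier_null_times_cis:
  assumes "fourier_null f"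
  shows "fourier_null (\<lambda>x. f x * cis (of_int k * x))"
  using assms unfolding fourier_null_def
  by (auto simp: mult.assoc cis_mult of_int_add[symmetric] distrib_right[symmetric]
      simp del: of_int_add intro!: continuous_intros)

text \<open>On the circle a real-linear function is a combination of \<open>cis x\<close> and
  \<open>cis (-x)\<close>, and multiplication by these only shifts the Fourier coefficients.
  \<open>f\<close> is arbitrary in the induction because a product of polynomials is multiplied on
  one factor at a time.\<close>

lemma fourier_null_times_polynomial:
  fixes p :: "complex \<Rightarrow> real"
  assumes "real_polynomial_function p" "fourier_null f"
  shows "fourier_null (\<lambda>x. f x * of_real (p (cis x)))"
  using assms
proof (induction arbitrary: f rule: real_polynomial_function.induct)
  case (linear p)
  then interpret bounded_linear p by simp
  have p: "complex_of_real (p (cis x)) = (p 1 - \<i> * p \<i>) / 2 * cis (of_int 1 * x) +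
      (p 1 + \<i> * p \<i>) / 2 * cis (of_int (-1) * x)" for x
  proof -
    have "p (cis x) = p (cos x *\<^sub>R 1 + sin x *\<^sub>R \<i>)"
      by (rule arg_cong[where f = p]) (simp add: complex_eq_iff)
    also have "\<dots> = cos x * p 1 + sin x * p \<i>" by (simp add: add scaleR)
    finally show ?thesis by (simp add: complex_eq_iff field_simps)
  qed
  have "fourier_null (\<lambda>x. (p 1 - \<i> * p \<i>) / 2 * (f x * cis (of_int 1 * x)) +
     (p 1 + \<i> * p \<i>) / 2 * (f x * cis (of_int (-1) * x)))"
    by (intro fourier_null_add fourier_null_cmult fourier_null_times_cis linear.prems)
  then show ?case
    unfolding p by (simp add: algebra_simps)
next
  case (const c)
  then show ?case by (subst mult.commute) (rule fourier_null_cmult)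
next
  case (add p q)
  then show ?case by (simp add: distrib_left fourier_null_add)
next
  case (mult p q)
  from mult.IH(2)[OF mult.IH(1)[OF mult.prems]] show ?case by (simp add: mult.assoc)
qed

text \<open>By the Stone--Weierstrass theorem on the circle, a function all of whose Fourier
  coefficients vanish is orthogonal to itself.\<close>

theorem fourier_null_imp_zero:
  assumes null: "fourier_null f" and per: "\<And>x. f (x + 2 * pi) = f x"
  shows "f x = 0"
proof -
  have cont: "continuous_on UNIV f" using null by (simp add: fourier_null_def)
  note [continuous_intros] = continuous_on_subset[OF cont subset_UNIV]
  define F where "F z = f (Arg2pi z)" for z
  have F: "F (cis x) = f x" for x
  proof -
    have "cis (Arg2pi (cis x)) = cis x"
      using Arg2pi_eq[of "cis x"] by (simp add: cis_conv_exp)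
    then show ?thesis unfolding F_def by (rule periodic_cis_cong[of f, OF per])
  qed
  have cF: "continuous_on (sphere 0 1) (\<lambda>z. cnj (F z))"
    unfolding F_def using continuous_on_circle_of_periodic[OF cont per] by (intro continuous_intros)
  have "compact (f ` {0..2*pi})"
    by (intro compact_continuous_image continuous_intros) auto
  then obtain M where M: "\<And>x. x \<in> {0..2 * pi} \<Longrightarrow> cmod (f x) \<le> M"
    by (meson compact_imp_bounded bounded_iff imageI)
  then have M0: "M \<ge> 0" using order_trans[OF norm_ge_zero M[of 0]] by simp
  \<comment> \<open>Approximate the conjugate of \<open>f\<close> on the circle within
    \<open>e\<close> by a polynomial \<open>g\<close>. As the integral of \<open>f\<close> times
    \<open>g\<close> vanishes, only \<open>f\<close> times the error remains, and that is at most
    \<open>M * e\<close> pointwise.\<close>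
  have small: "cmod (integral {0..2 * pi} (\<lambda>x. f x * cnj (f x))) \<le> e * (M * (2 * pi))" if "e > 0" for e
  proof -
    obtain g where g: "polynomial_function g" "\<And>z. z \<in> sphere 0 1 \<Longrightarrow> cmod (cnj (F z) - g z) < e"
      using Stone_Weierstrass_polynomial_function[OF _ cF \<open>e > 0\<close>] by auto
    have gp: "real_polynomial_function (\<lambda>z. Re (g z))" "real_polynomial_function (\<lambda>z. Im (g z))"
      using g(1) bounded_linear_Re bounded_linear_Im by (auto simp: polynomial_function_def o_def)
    have "fourier_null (\<lambda>x. f x * of_real (Re (g (cis x))) + \<i> * (f x * of_real (Im (g (cis x)))))"
      by (intro fourier_null_add fourier_null_cmult fourier_null_times_polynomial[OF _ null] gp)
    also have "(\<lambda>x. f x * of_real (Re (g (cis x))) + \<i> * (f x * of_real (Im (g (cis x))))) =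
        (\<lambda>x. f x * g (cis x))"
      by (rule ext, subst (4) complex_eq) (simp add: algebra_simps)
    finally have N: "fourier_null (\<lambda>x. f x * g (cis x))" .
    have "integral {0..2*pi} (\<lambda>x. f x * g (cis x)) = 0"
      using N unfolding fourier_null_def by (auto dest: spec[of _ 0])
    moreover have "(\<lambda>x. f x * g (cis x)) integrable_on {0..2*pi}"
      using N unfolding fourier_null_def
      by (intro integrable_continuous_real) (blast intro: continuous_on_subset)
    moreover have "(\<lambda>x. f x * cnj (f x)) integrable_on {0..2*pi}"
      by (intro integrable_continuous_real continuous_intros)
    ultimately have "integral {0..2*pi} (\<lambda>x. f x * cnj (f x)) =
        integral {0..2*pi} (\<lambda>x. f x * cnj (f x) - f x * g (cis x))"
      by (subst integral_diff) auto
    also have "cmod \<dots> \<le> integral {0..2*pi} (\<lambda>x. M * e)"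
    proof (rule integral_norm_bound_integral)
      show "(\<lambda>x. f x * cnj (f x) - f x * g (cis x)) integrable_on {0..2*pi}"
        using \<open>(\<lambda>x. f x * g (cis x)) integrable_on _\<close> \<open>(\<lambda>x. f x * cnj (f x)) integrable_on _\<close>
        by (rule integrable_diff[rotated])
      fix x assume "x \<in> {0..2*pi}"
      then have "cmod (f x) * cmod (cnj (f x) - g (cis x)) \<le> M * e"
        using M[of x] g(2)[of "cis x"] M0 by (intro mult_mono) (auto simp: F)
      then show "cmod (f x * cnj (f x) - f x * g (cis x)) \<le> M * e"
        by (simp add: right_diff_distrib[symmetric] norm_mult)
    qed (intro integrable_continuous_real continuous_intros)
    finally show ?thesis by (simp add: mult_ac)
  qed
  have "integral {0..2 * pi} (\<lambda>x. f x * cnj (f x)) = 0"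
  proof (rule ccontr)
    let ?I = "cmod (integral {0..2 * pi} (\<lambda>x. f x * cnj (f x)))"
    have aux: "x / (2 * (y + 1)) * y < x" if "x > 0" "y \<ge> 0" for x y :: real
      using that mult_nonneg_nonneg[of x y] by (simp add: divide_less_eq)
    assume "\<not> ?thesis"
    then have I: "?I > 0" by simp
    \<comment> \<open>This is \<open>small\<close> with e = I / (2 (2 pi M + 1)); the added 1 keeps
      the divisor positive when \<open>M\<close> is 0.\<close>
    have "?I \<le> ?I / (2 * (M * (2 * pi) + 1)) * (M * (2 * pi))"
      using I M0 by (intro small divide_pos_pos) (auto intro!: add_nonneg_pos)
    also have "\<dots> < ?I"
      using I M0 aux[of ?I "M * (2 * pi)"] by simp
    finally show False by simp
  qed
  then have "Re (integral {0..2 * pi} (\<lambda>x. f x * cnj (f x))) = 0" by simp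
  also have "Re (integral {0..2 * pi} (\<lambda>x. f x * cnj (f x))) = integral {0..2 * pi} (\<lambda>x. Re (f x * cnj (f x)))"
  proof -
    have "(\<lambda>x. f x * cnj (f x)) integrable_on {0..2 * pi}"
      by (intro integrable_continuous_real continuous_intros)
    from integral_linear[OF this bounded_linear_Re] show ?thesis by (simp add: o_def)
  qed
  also have "\<dots> = integral {0..2 * pi} (\<lambda>x. (cmod (f x))\<^sup>2)"
    by (simp add: complex_mult_cnj cmod_power2)
  finally have "\<forall>x\<in>{0..2*pi}. (cmod (f x))\<^sup>2 = 0"
    by (subst (asm) integral_eq_0_iff) (auto intro!: continuous_intros)
  \<comment> \<open>Vanishing is known on one period only; \<open>Arg2pi\<close> brings an arbitrary
    \<open>x\<close> back into it.\<close>
  moreover have "Arg2pi (cis x) \<in> {0..2*pi}" using Arg2pi[of "cis x"] by auto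
  ultimately show "f x = 0" using F[of x] unfolding F_def by auto
qed

section \<open>The first-order system\<close>

text \<open>\<open>p\<close> and \<open>q\<close> are the partial derivatives in the real and
  imaginary directions. Naming them as functions, rather than keeping an operator-valued derivative,
  lets them be integrated directly.\<close>

definition has_partials :: "(complex \<Rightarrow> complex) \<Rightarrow> (complex \<Rightarrow> complex) \<Rightarrow> (complex \<Rightarrow> complex) \<Rightarrow> bool" where
  "has_partials f p q \<longleftrightarrow> continuous_on UNIV p \<and> continuous_on UNIV q \<and>
     (\<forall>z. (f has_derivative (\<lambda>v. of_real (Re v) * p z + of_real (Im v) * q z)) (at z))"

text \<open>A real-linear map on the plane is determined by its values at 1 and \<open>\<i>\<close>,
  and in finite dimension continuity of an operator-valued map can be tested on a basis.\<close>

lemma C1_fun_iff_has_partials: "C1_fun f \<longleftrightarrow> (\<exists>p q. has_partials f p q)"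
proof
  assume "C1_fun f"
  then obtain f' where f': "\<And>z. (f has_derivative blinfun_apply (f' z)) (at z)" "continuous_on UNIV f'"
    unfolding C1_fun_def by blast
  have lin: "blinfun_apply (f' z) v = of_real (Re v) * blinfun_apply (f' z) 1 + of_real (Im v) * blinfun_apply (f' z) \<i>"
    for z v
  proof -
    have "blinfun_apply (f' z) (Re v *\<^sub>R 1 + Im v *\<^sub>R \<i>) =
        of_real (Re v) * blinfun_apply (f' z) 1 + of_real (Im v) * blinfun_apply (f' z) \<i>"
      unfolding blinfun.add_right blinfun.scaleR_right by (simp add: scaleR_conv_of_real)
    then show ?thesis by (simp add: scaleR_conv_of_real complex_eq[symmetric] mult.commute)
  qed
  have eq: "(\<lambda>v. of_real (Re v) * blinfun_apply (f' z) 1 + of_real (Im v) * blinfun_apply (f' z) \<i>) = blinfun_apply (f' z)" for z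
    by (rule ext) (rule lin[symmetric])
  have "continuous_on UNIV (\<lambda>z. blinfun_apply (f' z) w)" for w
    using f'(2) by (intro blinfun.continuous_on continuous_on_const)
  with f'(1) have "has_partials f (\<lambda>z. blinfun_apply (f' z) 1) (\<lambda>z. blinfun_apply (f' z) \<i>)"
    unfolding has_partials_def eq by blast
  then show "\<exists>p q. has_partials f p q" by blast
next
  assume "\<exists>p q. has_partials f p q"
  then obtain p q where pq: "has_partials f p q" by blast
  define f' where "f' z = Blinfun (\<lambda>v. of_real (Re v) * p z + of_real (Im v) * q z)" for z
  have f': "blinfun_apply (f' z) = (\<lambda>v. of_real (Re v) * p z + of_real (Im v) * q z)" for z
    unfolding f'_def using pq by (intro bounded_linear_Blinfun_apply has_derivative_bounded_linear) (auto simp: has_partials_def)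
  have "continuous_on UNIV f'"
    by (rule continuous_on_blinfun_componentwise)
       (use pq in \<open>auto simp: f' Basis_complex_def has_partials_def\<close>)
  then show "C1_fun f"
    using pq unfolding C1_fun_def has_partials_def by (intro exI[of _ f']) (auto simp: f')
qed

lemma has_partials_frechet_derivative:
  assumes "has_partials f p q"
  shows "frechet_derivative f (at z) 1 = p z" "frechet_derivative f (at z) \<i> = q z"
  using frechet_derivative_at[of f _ z] assms unfolding has_partials_def
  by (metis (no_types, lifting) add.right_neutral mult_1 mult_zero_left of_real_0 of_real_1 one_complex.sel
      imaginary_unit.sel add.left_neutral)+

text \<open>2 i \<open>d_z\<close> is i (p - i q) and 2 i \<open>d_zbar\<close> is i (p + i q);
  multiplication by -i clears the outer factor.\<close>

lemma solves_system_iff_partials: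
  "solves_system \<mu> u v \<longleftrightarrow> (\<exists>p q p' q'. has_partials u p q \<and> has_partials v p' q' \<and>
     (\<forall>z. p z - \<i> * q z = - \<i> * of_real \<mu> * v z \<and> p' z + \<i> * q' z = - \<i> * of_real \<mu> * u z))"
proof -
  have eq: "\<i> * a = b \<longleftrightarrow> a = - \<i> * b" for a b :: complex
    by (auto simp: complex_eq_iff)
  have "2 * \<i> * d_z u z = of_real \<mu> * v z \<longleftrightarrow> p z - \<i> * q z = - \<i> * of_real \<mu> * v z"
    if "has_partials u p q" for u v p q z
    using eq[of "p z - \<i> * q z" "of_real \<mu> * v z"]
    by (simp add: d_z_def has_partials_frechet_derivative[OF that] mult.assoc)
  moreover have "2 * \<i> * d_zbar u z = of_real \<mu> * v z \<longleftrightarrow> p z + \<i> * q z = - \<i> * of_real \<mu> * v z"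
    if "has_partials u p q" for u v p q z
    using eq[of "p z + \<i> * q z" "of_real \<mu> * v z"]
    by (simp add: d_zbar_def has_partials_frechet_derivative[OF that] mult.assoc)
  ultimately show ?thesis
    unfolding solves_system_def C1_fun_iff_has_partials by meson
qed

lemma has_partials_continuous: "has_partials f p q \<Longrightarrow> continuous_on A f"
  unfolding has_partials_def using has_derivative_continuous
  by (blast intro: continuous_at_imp_continuous_on)

lemma has_partials_translate:
  assumes "has_partials f p q"
  shows "has_partials (\<lambda>z. f (z + c)) (\<lambda>z. p (z + c)) (\<lambda>z. q (z + c))"
proof -
  have "continuous_on UNIV (\<lambda>z. p (z + c))" "continuous_on UNIV (\<lambda>z. q (z + c))"
    using assms continuous_on_compose2[of UNIV p UNIV "\<lambda>z. z + c"]
      continuous_on_compose2[of UNIV q UNIV "\<lambda>z. z + c"]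
    unfolding has_partials_def by (simp_all add: continuous_intros)
  moreover have "((\<lambda>z. f (z + c)) has_derivative (\<lambda>v. of_real (Re v) * p (z + c) + of_real (Im v) * q (z + c))) (at z)" for z
  proof -
    have "(f has_derivative (\<lambda>v. of_real (Re v) * p (z + c) + of_real (Im v) * q (z + c))) (at (z + c))"
      using assms unfolding has_partials_def by blast
    moreover have "((\<lambda>z. z + c) has_derivative (\<lambda>v. v)) (at z)"
      by (auto intro!: derivative_eq_intros)
    ultimately show ?thesis
      using has_derivative_compose[where f = "\<lambda>z. z + c" and g = f and x = z and f' = "\<lambda>v. v"] by blast
  qed
  ultimately show ?thesis unfolding has_partials_def by blast
qed

lemma has_partials_lincomb:
  assumes "has_partials f p q" "has_partials g r s"
  shows "has_partials (\<lambda>z. f z + c * g z) (\<lambda>z. p z + c * r z) (\<lambda>z. q z + c * s z)"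
proof -
  have "((\<lambda>z. f z + c * g z) has_derivative
      (\<lambda>v. of_real (Re v) * (p z + c * r z) + of_real (Im v) * (q z + c * s z))) (at z)" for z
  proof -
    have "(f has_derivative (\<lambda>v. of_real (Re v) * p z + of_real (Im v) * q z)) (at z)"
      "(g has_derivative (\<lambda>v. of_real (Re v) * r z + of_real (Im v) * s z)) (at z)"
      using assms unfolding has_partials_def by blast+
    from has_derivative_add[OF this(1) has_derivative_mult_right[OF this(2)]]
    show ?thesis by (rule has_derivative_eq_rhs) (simp add: algebra_simps)
  qed
  then show ?thesis
    using assms unfolding has_partials_def by (auto intro!: continuous_intros)
qed

lemma solves_system_translate:
  assumes "solves_system \<mu> u v"
  shows "solves_system \<mu> (\<lambda>z. u (z + c)) (\<lambda>z. v (z + c))"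
proof -
  obtain p q r s where "has_partials u p q" "has_partials v r s"
     "\<And>z. p z - \<i> * q z = - \<i> * of_real \<mu> * v z \<and> r z + \<i> * s z = - \<i> * of_real \<mu> * u z"
    using assms unfolding solves_system_iff_partials by blast
  then show ?thesis
    unfolding solves_system_iff_partials
    by (intro exI[of _ "\<lambda>z. p (z + c)"] exI[of _ "\<lambda>z. q (z + c)"] exI[of _ "\<lambda>z. r (z + c)"]
        exI[of _ "\<lambda>z. s (z + c)"] conjI allI has_partials_translate) auto
qed

text \<open>The system is complex linear. The case c = -1 gives the differences to which uniqueness
  is applied, c = 1 the finite sums of plane waves.\<close>

lemma solves_system_lincomb:
  assumes "solves_system \<mu> u v" "solves_system \<mu> u' v'"
  shows "solves_system \<mu> (\<lambda>z. u z + c * u' z) (\<lambda>z. v z + c * v' z)"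
proof -
  obtain p q r s where 1: "has_partials u p q" "has_partials v r s"
     "\<And>z. p z - \<i> * q z = - \<i> * of_real \<mu> * v z" "\<And>z. r z + \<i> * s z = - \<i> * of_real \<mu> * u z"
    using assms(1) unfolding solves_system_iff_partials by blast
  obtain p' q' r' s' where 2: "has_partials u' p' q'" "has_partials v' r' s'"
     "\<And>z. p' z - \<i> * q' z = - \<i> * of_real \<mu> * v' z" "\<And>z. r' z + \<i> * s' z = - \<i> * of_real \<mu> * u' z"
    using assms(2) unfolding solves_system_iff_partials by blast
  have "(p z + c * p' z) - \<i> * (q z + c * q' z) = - \<i> * of_real \<mu> * (v z + c * v' z)"
       "(r z + c * r' z) + \<i> * (s z + c * s' z) = - \<i> * of_real \<mu> * (u z + c * u' z)" for z
    using 1(3)[of z] 2(3)[of z] 1(4)[of z] 2(4)[of z] by algebra+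
  then show ?thesis
    using has_partials_lincomb[OF 1(1) 2(1), of c] has_partials_lincomb[OF 1(2) 2(2), of c]
    unfolding solves_system_iff_partials by blast
qed

section \<open>Unique continuation\<close>

text \<open>The weighted energy |y|^2 exp (-2 C t) has nonpositive derivative by Cauchy-Schwarz, and
  it starts at 0.\<close>

lemma vector_gronwall_zero:
  fixes y :: "real \<Rightarrow> 'a::real_inner"
  assumes "\<And>t. a \<le> t \<Longrightarrow> t \<le> b \<Longrightarrow> (y has_vector_derivative y' t) (at t)"
    and "\<And>t. a \<le> t \<Longrightarrow> t \<le> b \<Longrightarrow> norm (y' t) \<le> C * norm (y t)"
    and "a \<le> b" "y a = 0"
  shows "y b = 0"
proof -
  define E where "E t = inner (y t) (y t) * exp (- (2 * C) * t)" for t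
  have "E b \<le> E a"
  proof (rule DERIV_nonpos_imp_nonincreasing[OF \<open>a \<le> b\<close>])
    fix t assume t: "a \<le> t" "t \<le> b"
    have "((\<lambda>t. inner (y t) (y t)) has_real_derivative 2 * inner (y t) (y' t)) (at t)"
      using has_derivative_inner[OF assms(1)[OF t, unfolded has_vector_derivative_def]
          assms(1)[OF t, unfolded has_vector_derivative_def]]
      unfolding has_field_derivative_def
      by (rule has_derivative_eq_rhs) (auto simp: inner_commute algebra_simps)
    then have "(E has_real_derivative (2 * inner (y t) (y' t) - 2 * C * inner (y t) (y t)) * exp (- (2 * C) * t)) (at t)"
      unfolding E_def by (auto intro!: derivative_eq_intros simp: algebra_simps)
    moreover have "inner (y t) (y' t) \<le> C * inner (y t) (y t)"
    proof -
      have "inner (y t) (y' t) \<le> norm (y t) * norm (y' t)" by (rule norm_cauchy_schwarz)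
      also have "\<dots> \<le> norm (y t) * (C * norm (y t))" using assms(2)[OF t] by (rule mult_left_mono) auto
      finally show ?thesis by (simp add: power2_norm_eq_inner[symmetric] power2_eq_square algebra_simps)
    qed
    ultimately show "\<exists>d. (E has_real_derivative d) (at t) \<and> d \<le> 0"
      by (intro exI conjI) (auto simp: mult_le_0_iff)
  qed
  then have "inner (y b) (y b) \<le> 0"
    unfolding E_def using assms(4) by (simp add: mult_le_0_iff)
  then show ?thesis by (metis inner_gt_zero_iff not_le)
qed

text \<open>Up to the factor 1 / (2 pi), this is the Fourier coefficient of index \<open>-k\<close>
  of \<open>f\<close> on the circle of radius \<open>r\<close> about \<open>c\<close>.\<close>

definition angular_coeff :: "(complex \<Rightarrow> complex) \<Rightarrow> complex \<Rightarrow> int \<Rightarrow> real \<Rightarrow> complex" where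
  "angular_coeff f c k r = integral {0..2 * pi} (\<lambda>t. f (c + of_real r * cis t) * cis (of_int k * t))"

lemma has_vector_derivative_along:
  assumes "has_partials f p q" "(\<gamma> has_vector_derivative d) (at t within S)"
  shows "((\<lambda>t. f (\<gamma> t)) has_vector_derivative of_real (Re d) * p (\<gamma> t) + of_real (Im d) * q (\<gamma> t)) (at t within S)"
proof -
  have "(f has_derivative (\<lambda>v. of_real (Re v) * p (\<gamma> t) + of_real (Im v) * q (\<gamma> t))) (at (\<gamma> t))"
    using assms(1) unfolding has_partials_def by blast
  from has_derivative_compose[OF assms(2)[unfolded has_vector_derivative_def] this]
  show ?thesis unfolding has_vector_derivative_def
    by (rule has_derivative_eq_rhs) (auto simp: scaleR_conv_of_real algebra_simps)
qed

text \<open>In polar coordinates p - i q = e^(-it) (d/dr - (i/r) d/dt) f and p + i q = e^(it) (d/dr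
  + (i/r) d/dt) f. Solving either for the radial derivative and integrating the angular term by
  parts gives two formulas for the same derivative; the factor e^(it) or e^(-it) shifts the index by
  one.\<close>

lemma angular_coeff_has_derivative:
  assumes f: "has_partials f p q" and "r > 0"
  shows "(angular_coeff f c k has_vector_derivative
           angular_coeff (\<lambda>z. p z - \<i> * q z) c (k + 1) r + of_int k / of_real r * angular_coeff f c k r) (at r)"
    and "(angular_coeff f c k has_vector_derivative
           angular_coeff (\<lambda>z. p z + \<i> * q z) c (k - 1) r - of_int k / of_real r * angular_coeff f c k r) (at r)"
proof -
  have cp: "continuous_on A p" "continuous_on A q" "continuous_on A f" for A
    using f has_partials_continuous[OF f] unfolding has_partials_def by (auto intro: continuous_on_subset)
  note ci = continuous_on_compose2[OF cp(1)[of UNIV] _ subset_UNIV] continuous_on_compose2[OF cp(2)[of UNIV] _ subset_UNIV]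
     continuous_on_compose2[OF cp(3)[of UNIV] _ subset_UNIV]
  \<comment> \<open>\<open>R\<close> is the radial derivative of the integrand; \<open>T\<close>
    below is the derivative of \<open>f\<close> along the circle, divided by \<open>r\<close> and
    multiplied by the exponential.\<close>
  define R where "R r t = (of_real (cos t) * p (c + of_real r * cis t) + of_real (sin t) * q (c + of_real r * cis t)) * cis (of_int k * t)" for r t
  define T where "T t = (- of_real (sin t) * p (c + of_real r * cis t) + of_real (cos t) * q (c + of_real r * cis t)) * cis (of_int k * t)" for t
  have "((\<lambda>r. integral (cbox 0 (2 * pi)) (\<lambda>t. f (c + of_real r * cis t) * cis (of_int k * t)))
      has_vector_derivative integral (cbox 0 (2 * pi)) (R r)) (at r within UNIV)"
  proof (rule leibniz_rule_vector_derivative)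
    fix r t :: real
    have "((\<lambda>r. c + of_real r * cis t) has_vector_derivative cis t) (at r within UNIV)"
      unfolding has_vector_derivative_def by (auto intro!: derivative_eq_intros simp: scaleR_conv_of_real)
    from has_vector_derivative_along[OF f this]
    show "((\<lambda>r. f (c + of_real r * cis t) * cis (of_int k * t)) has_vector_derivative R r t) (at r within UNIV)"
      unfolding R_def by (simp add: has_vector_derivative_mult_left)
  next
    show "continuous_on (UNIV \<times> cbox 0 (2*pi)) (\<lambda>(r, t). R r t)"
      unfolding R_def split_beta by (intro continuous_intros ci)
  next
    show "(\<lambda>t. f (c + of_real r * cis t) * cis (of_int k * t)) integrable_on cbox 0 (2 * pi)" for r
      unfolding cbox_interval by (intro integrable_continuous_real continuous_intros ci)
  qed auto
  then have 1: "(angular_coeff f c k has_vector_derivative integral {0..2 * pi} (R r)) (at r)"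
    unfolding angular_coeff_def by simp
  have iT: "T integrable_on {0..2*pi}" and iF: "(\<lambda>t. f (c + of_real r * cis t) * cis (of_int k * t)) integrable_on {0..2*pi}"
    and iT2: "(\<lambda>t. \<i> * T t) integrable_on {0..2*pi}"
    unfolding T_def by (intro integrable_continuous_real continuous_intros ci)+
  have i1: "(\<lambda>t. (p (c + of_real r * cis t) - \<i> * q (c + of_real r * cis t)) * cis (of_int (k + 1) * t)) integrable_on {0..2*pi}"
    and i2: "(\<lambda>t. (p (c + of_real r * cis t) + \<i> * q (c + of_real r * cis t)) * cis (of_int (k - 1) * t)) integrable_on {0..2*pi}"
    by (intro integrable_continuous_real continuous_intros ci)+
  \<comment> \<open>Integration by parts in the angle: the left side is the angular derivative of
    the whole integrand, and the boundary values agree after a full turn.\<close>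
  have "((\<lambda>t. of_real r * T t + \<i> * of_int k * (f (c + of_real r * cis t) * cis (of_int k * t))) has_integral
      f (c + of_real r * cis (2 * pi)) * cis (of_int k * (2 * pi)) - f (c + of_real r * cis 0) * cis (of_int k * 0)) {0..2*pi}"
  proof (rule fundamental_theorem_of_calculus)
    fix t :: real assume "t \<in> {0..2*pi}"
    have "((\<lambda>t. c + of_real r * cis t) has_vector_derivative of_real r * (\<i> * cis t)) (at t within {0..2*pi})"
      unfolding has_vector_derivative_def by (auto intro!: derivative_eq_intros simp: scaleR_conv_of_real)
    note 2 = has_vector_derivative_along[OF f this]
    have 3: "((\<lambda>t. cis (of_int k * t)) has_vector_derivative \<i> * of_int k * cis (of_int k * t)) (at t within {0..2*pi})"
      unfolding has_vector_derivative_def by (auto intro!: derivative_eq_intros simp: scaleR_conv_of_real)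
    show "((\<lambda>t. f (c + of_real r * cis t) * cis (of_int k * t)) has_vector_derivative
        of_real r * T t + \<i> * of_int k * (f (c + of_real r * cis t) * cis (of_int k * t))) (at t within {0..2*pi})"
      using has_vector_derivative_mult[OF 2 3] by (rule has_vector_derivative_eq_rhs)
        (simp add: T_def algebra_simps)
  qed simp
  moreover have "cis (of_int k * (2 * pi)) = 1"
    using cis_multiple_2pi[of "of_int k"] by (simp add: mult.commute)
  ultimately have "((\<lambda>t. of_real r * T t + \<i> * of_int k * (f (c + of_real r * cis t) * cis (of_int k * t))) has_integral 0) {0..2*pi}"
    by simp
  then have "of_real r * integral {0..2*pi} T + \<i> * of_int k * angular_coeff f c k r = 0"
    unfolding angular_coeff_def
    using has_integral_add[OF has_integral_mult_right[OF integrable_integral[OF iT]] has_integral_mult_right[OF integrable_integral[OF iF]]]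
    by (rule has_integral_unique[rotated])
  then have 0: "of_real r * integral {0..2*pi} T = - \<i> * of_int k * angular_coeff f c k r"
    by (simp add: eq_neg_iff_add_eq_0)
  have iT': "\<i> * integral {0..2*pi} T = of_int k / of_real r * angular_coeff f c k r"
  proof -
    have "of_real r * (\<i> * integral {0..2*pi} T) = of_int k * angular_coeff f c k r"
      using arg_cong[OF 0, of "\<lambda>x. \<i> * x"] by (simp add: algebra_simps)
    then show ?thesis using \<open>r > 0\<close> by (simp add: field_simps)
  qed
  have "R r = (\<lambda>t. (p (c + of_real r * cis t) - \<i> * q (c + of_real r * cis t)) * cis (of_int (k + 1) * t) + \<i> * T t)"
  proof
    fix t
    have *: "cis (of_int (k + 1) * t) = cis (of_int k * t) * (of_real (cos t) + \<i> * of_real (sin t))"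
      by (simp add: distrib_right cis_mult[symmetric]) (simp add: complex_eq_iff)
    show "R r t = (p (c + of_real r * cis t) - \<i> * q (c + of_real r * cis t)) * cis (of_int (k + 1) * t) + \<i> * T t"
      unfolding R_def T_def * by (simp add: algebra_simps)
  qed
  then have "integral {0..2*pi} (R r) = angular_coeff (\<lambda>z. p z - \<i> * q z) c (k + 1) r + \<i> * integral {0..2*pi} T"
    unfolding angular_coeff_def
    by (simp del: of_int_add add: integral_add[OF i1 iT2])
  with 1 show "(angular_coeff f c k has_vector_derivative
           angular_coeff (\<lambda>z. p z - \<i> * q z) c (k + 1) r + of_int k / of_real r * angular_coeff f c k r) (at r)"
    by (simp only: iT')
  have "R r = (\<lambda>t. (p (c + of_real r * cis t) + \<i> * q (c + of_real r * cis t)) * cis (of_int (k - 1) * t) - \<i> * T t)"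
  proof
    fix t
    have *: "cis (of_int (k - 1) * t) = cis (of_int k * t) * (of_real (cos t) - \<i> * of_real (sin t))"
      by (simp add: left_diff_distrib cis_divide[symmetric] divide_inverse del: cis_inverse) (simp add: complex_eq_iff)
    show "R r t = (p (c + of_real r * cis t) + \<i> * q (c + of_real r * cis t)) * cis (of_int (k - 1) * t) - \<i> * T t"
      unfolding R_def T_def * by (simp add: algebra_simps)
  qed
  then have "integral {0..2*pi} (R r) = angular_coeff (\<lambda>z. p z + \<i> * q z) c (k - 1) r - \<i> * integral {0..2*pi} T"
    unfolding angular_coeff_def
    by (simp del: of_int_diff add: integral_diff[OF i2 iT2])
  with 1 show "(angular_coeff f c k has_vector_derivative
           angular_coeff (\<lambda>z. p z + \<i> * q z) c (k - 1) r - of_int k / of_real r * angular_coeff f c k r) (at r)"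
    by (simp only: iT')
qed

lemma angular_coeff_cmult: "angular_coeff (\<lambda>z. d * f z) c k r = d * angular_coeff f c k r"
  by (simp add: angular_coeff_def mult.assoc)

text \<open>At fixed radius the angular coefficients are all the Fourier coefficients of the
  restriction of \<open>f\<close> to the circle through \<open>z\<close>, so uniqueness in one
  variable applies.\<close>

lemma zero_on_circle:
  assumes "continuous_on UNIV f" "\<And>k. angular_coeff f c k (cmod (z - c)) = 0"
  shows "f z = 0"
proof -
  define r where "r = cmod (z - c)"
  have z: "z = c + of_real r * cis (Arg2pi (z - c))"
    using Arg2pi_eq[of "z - c"] by (simp add: r_def cis_conv_exp)
  have "f (c + of_real r * cis (Arg2pi (z - c))) = 0"
  proof (rule fourier_null_imp_zero[of "\<lambda>t. f (c + of_real r * cis t)"])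
    show "fourier_null (\<lambda>t. f (c + of_real r * cis t))"
      unfolding fourier_null_def
    proof (intro conjI allI)
      show "continuous_on UNIV (\<lambda>t. f (c + of_real r * cis t))"
        by (rule continuous_on_compose2[OF assms(1)]) (auto intro!: continuous_intros)
      show "integral {0..2 * pi} (\<lambda>t. f (c + of_real r * cis t) * cis (of_int k * t)) = 0" for k
        using assms(2)[of k] by (simp add: angular_coeff_def r_def)
    qed
    show "f (c + of_real r * cis (t + 2 * pi)) = f (c + of_real r * cis t)" for t
      by (simp flip: cis_mult)
  qed
  then show ?thesis using z by simp
qed

text \<open>In polar coordinates around the centre of the ball, the angular Fourier coefficients of a
  solution satisfy a linear system of ordinary differential equations in the radius, so they
  remain zero once they are zero for a small radius.\<close>

theorem solves_system_unique_continuation: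
  assumes sol: "solves_system \<mu> u v" and "\<epsilon> > 0"
    and zero: "\<And>z. z \<in> ball c \<epsilon> \<Longrightarrow> u z = 0 \<and> v z = 0"
  shows "u z = 0 \<and> v z = 0"
proof (cases "cmod (z - c) < \<epsilon>")
  case True
  then show ?thesis using zero[of z] by (simp add: dist_norm norm_minus_commute)
next
  case False
  obtain p q p' q' where pq: "has_partials u p q" "has_partials v p' q'"
    and eq: "\<And>z. p z - \<i> * q z = - \<i> * of_real \<mu> * v z" "\<And>z. p' z + \<i> * q' z = - \<i> * of_real \<mu> * u z"
    using sol unfolding solves_system_iff_partials by blast
  \<comment> \<open>The radial equation starts at a positive radius inside the ball, since its
    coefficients k / r are singular at the centre.\<close>
  define a where "a = \<epsilon> / 2"
  have a: "a > 0" "a \<le> cmod (z - c)" using False \<open>\<epsilon> > 0\<close> by (auto simp: a_def)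
  define A where "A = angular_coeff u c"
  define B where "B = angular_coeff v c"
  \<comment> \<open>The first equation of the system raises the angular index by one and the second
    lowers it, so the pair of \<open>A k\<close> and \<open>B (k + 1)\<close> satisfies a closed
    two-dimensional linear equation.\<close>
  have "A k (cmod (z - c)) = 0 \<and> B (k + 1) (cmod (z - c)) = 0" for k
  proof -
    define y where "y t = (A k t, B (k + 1) t)" for t
    define y' where "y' t = (- \<i> * of_real \<mu> * B (k + 1) t + of_int k / of_real t * A k t,
        - \<i> * of_real \<mu> * A k t - of_int (k + 1) / of_real t * B (k + 1) t)" for t
    have "y (cmod (z - c)) = 0"
    proof (rule vector_gronwall_zero[OF _ _ a(2)])
      fix t assume t: "a \<le> t"
      then have t0: "t > 0" using a by simp
      have "(A k has_vector_derivative - \<i> * of_real \<mu> * B (k + 1) t + of_int k / of_real t * A k t) (at t)"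
        using angular_coeff_has_derivative(1)[OF pq(1) t0, of c k]
        by (simp only: eq A_def B_def angular_coeff_cmult)
      moreover have "(B (k + 1) has_vector_derivative - \<i> * of_real \<mu> * A k t - of_int (k + 1) / of_real t * B (k + 1) t) (at t)"
        using angular_coeff_has_derivative(2)[OF pq(2) t0, of c "k + 1"]
        by (simp only: eq A_def B_def angular_coeff_cmult add_diff_cancel_right')
      ultimately show "(y has_vector_derivative y' t) (at t)"
        unfolding y_def y'_def by (rule has_vector_derivative_Pair)
      have 1: "cmod (A k t) \<le> norm (y t)" "cmod (B (k + 1) t) \<le> norm (y t)"
        unfolding y_def by (rule norm_fst_le norm_snd_le)+
      \<comment> \<open>From radius \<open>a\<close> outwards the singular coefficients are bounded,
        which yields one Gronwall constant for the whole interval.\<close>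
      have 2: "\<bar>of_int m\<bar> / t \<le> \<bar>of_int m\<bar> / a" for m
        using t a by (intro divide_left_mono) auto
      have "cmod (- \<i> * of_real \<mu> * B (k + 1) t + of_int k / of_real t * A k t) \<le>
          cmod (- \<i> * of_real \<mu> * B (k + 1) t) + cmod (of_int k / of_real t * A k t)"
        by (rule norm_triangle_ineq)
      also have "\<dots> = \<bar>\<mu>\<bar> * cmod (B (k + 1) t) + \<bar>of_int k\<bar> / t * cmod (A k t)"
        using t0 by (simp add: norm_mult norm_divide)
      also have "\<dots> \<le> \<bar>\<mu>\<bar> * norm (y t) + \<bar>of_int k\<bar> / a * norm (y t)"
        using 1 2[of k] t0 a by (intro add_mono mult_mono) auto
      finally have n1: "cmod (fst (y' t)) \<le> \<bar>\<mu>\<bar> * norm (y t) + \<bar>of_int k\<bar> / a * norm (y t)"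
        by (simp add: y'_def)
      have "cmod (- \<i> * of_real \<mu> * A k t - of_int (k + 1) / of_real t * B (k + 1) t) \<le>
          cmod (- \<i> * of_real \<mu> * A k t) + cmod (of_int (k + 1) / of_real t * B (k + 1) t)"
        by (rule norm_triangle_ineq4)
      also have "\<dots> = \<bar>\<mu>\<bar> * cmod (A k t) + \<bar>of_int (k + 1)\<bar> / t * cmod (B (k + 1) t)"
        using t0 by (simp add: norm_mult norm_divide del: of_int_add)
      also have "\<dots> \<le> \<bar>\<mu>\<bar> * norm (y t) + \<bar>of_int (k + 1)\<bar> / a * norm (y t)"
        using 1 2[of "k + 1"] t0 a by (intro add_mono mult_mono) auto
      finally have n2: "cmod (snd (y' t)) \<le> \<bar>\<mu>\<bar> * norm (y t) + \<bar>of_int (k + 1)\<bar> / a * norm (y t)"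
        by (simp add: y'_def)
      have "norm (y' t) \<le> cmod (fst (y' t)) + cmod (snd (y' t))"
        using norm_Pair_le[of "fst (y' t)" "snd (y' t)"] by simp
      with n1 n2 show "norm (y' t) \<le> (2 * \<bar>\<mu>\<bar> + \<bar>of_int k\<bar> / a + \<bar>of_int (k + 1)\<bar> / a) * norm (y t)"
        by (simp add: distrib_right)
    next
      have "c + of_real a * cis t \<in> ball c \<epsilon>" for t
        using \<open>\<epsilon> > 0\<close> by (simp add: dist_norm norm_mult a_def)
      then show "y a = 0"
        using zero by (simp add: y_def A_def B_def angular_coeff_def zero_prod_def)
    qed
    then show ?thesis by (simp add: y_def zero_prod_def)
  qed
  note AB = this
  have "A k (cmod (z - c)) = 0" "B k (cmod (z - c)) = 0" for k
    using AB[of k] AB[of "k - 1"] by simp_all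
  then show ?thesis
    using zero_on_circle[of u c z] zero_on_circle[of v c z] pq[THEN has_partials_continuous]
    by (simp add: A_def B_def)
qed

section \<open>The sign of a lattice translation\<close>

lemma quat_complex_pair_eq_iff:
  "quat_of_complex w + quat_j * quat_of_complex z = quat_of_complex w' + quat_j * quat_of_complex z' \<longleftrightarrow> w = w' \<and> z = z'"
  by (auto simp: quat_defs complex_eq_iff)

text \<open>As j v is a purely imaginary quaternion, so is its product with conj(lambda) on the left
  and lambda on the right; hence the complex component is imaginary.\<close>

lemma df_form_complex_pair:
  assumes "lam z = quat_of_complex a + quat_j * quat_of_complex b"
  shows "df_form lam z v = quat_of_complex (2 * \<i> * of_real (Im (cnj b * v * a))) +
     quat_j * quat_of_complex (a\<^sup>2 * v + b\<^sup>2 * cnj v)"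
  unfolding df_form_def assms
  by (simp add: quat_defs power2_eq_square) (simp add: algebra_simps)

text \<open>The form is quadratic in lambda. It determines u^2, v^2 and cnj v * u: the squares fix
  each component up to sign, and the product ties the two signs together.\<close>

lemma df_form_eq_iff:
  assumes "\<And>z. lam z = quat_of_complex (u z) + quat_j * quat_of_complex (v z)"
  shows "(\<forall>d. df_form lam x d = df_form lam y d) \<longleftrightarrow>
    (u x = u y \<and> v x = v y) \<or> (u x = - u y \<and> v x = - v y)"
proof
  assume *: "\<forall>d. df_form lam x d = df_form lam y d"
  have cancel: "2 * \<i> * complex_of_real s = 2 * \<i> * of_real t \<Longrightarrow> s = t" for s t by simp
  have eq: "Im (cnj (v x) * d * u x) = Im (cnj (v y) * d * u y)"
    "(u x)\<^sup>2 * d + (v x)\<^sup>2 * cnj d = (u y)\<^sup>2 * d + (v y)\<^sup>2 * cnj d" for d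
    using *[rule_format, of d]
    unfolding df_form_complex_pair[OF assms] quat_complex_pair_eq_iff by (blast intro: cancel)+
  \<comment> \<open>The tangent vectors 1 and \<open>\<i>\<close> give the sum and the difference of
    the squares; in the other component they give the imaginary and the real part of cnj v *
    u.\<close>
  have "(u x)\<^sup>2 + (v x)\<^sup>2 = (u y)\<^sup>2 + (v y)\<^sup>2" "(u x)\<^sup>2 - (v x)\<^sup>2 = (u y)\<^sup>2 - (v y)\<^sup>2"
    using eq(2)[of 1] eq(2)[of \<i>] by (simp_all add: algebra_simps complex_eq_iff)
  then have "(u x)\<^sup>2 = (u y)\<^sup>2" "(v x)\<^sup>2 = (v y)\<^sup>2" by algebra+
  then have "u x = u y \<or> u x = - u y" "v x = v y \<or> v x = - v y"
    by (auto simp: power2_eq_iff)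
  moreover have "cnj (v x) * u x = cnj (v y) * u y"
    using eq(1)[of 1] eq(1)[of \<i>] by (simp add: complex_eq_iff algebra_simps)
  \<comment> \<open>If the two signs differed, the product would equal its own negative, so one
    component would vanish and either sign would serve for it.\<close>
  ultimately show "(u x = u y \<and> v x = v y) \<or> (u x = - u y \<and> v x = - v y)"
    by (auto simp: eq_neg_iff_add_eq_0)
next
  assume "(u x = u y \<and> v x = v y) \<or> (u x = - u y \<and> v x = - v y)"
  then show "\<forall>d. df_form lam x d = df_form lam y d"
    unfolding df_form_complex_pair[OF assms]
    by (elim disjE conjE)
      (simp_all only: complex_cnj_minus mult_minus_left mult_minus_right minus_minus power2_minus simp_thms)
qed

text \<open>Where \<open>\<lambda>(z + \<gamma>) + \<lambda>(z) \<noteq> 0\<close>, the difference \<open>\<lambda>(z + \<gamma>) - \<lambda>(z)\<close> vanishes; so if the former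
  is not identically zero, the latter vanishes on a ball and hence everywhere.\<close>

lemma global_sign_of_pointwise_sign:
  assumes sol: "solves_system \<mu> u v"
    and pm: "\<And>z. (u (z + \<gamma>) = u z \<and> v (z + \<gamma>) = v z) \<or> (u (z + \<gamma>) = - u z \<and> v (z + \<gamma>) = - v z)"
  shows "(\<forall>z. u (z + \<gamma>) = u z \<and> v (z + \<gamma>) = v z) \<or> (\<forall>z. u (z + \<gamma>) = - u z \<and> v (z + \<gamma>) = - v z)"
proof (rule disjCI)
  assume "\<not> (\<forall>z. u (z + \<gamma>) = - u z \<and> v (z + \<gamma>) = - v z)"
  then obtain c where c: "\<not> (u (c + \<gamma>) = - u c \<and> v (c + \<gamma>) = - v c)" by blast
  let ?S = "{z. (u (z + \<gamma>), v (z + \<gamma>)) \<noteq> (- u z, - v z)}"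
  have cont: "continuous_on UNIV u" "continuous_on UNIV v"
    using sol unfolding solves_system_iff_partials by (blast intro: has_partials_continuous)+
  have "continuous_on UNIV (\<lambda>z. u (z + \<gamma>))" "continuous_on UNIV (\<lambda>z. v (z + \<gamma>))"
    by (rule continuous_on_compose2[OF cont(1)] continuous_on_compose2[OF cont(2)], auto intro!: continuous_intros)+
  then have "open ?S"
    using cont by (intro open_Collect_neq continuous_intros)
  then obtain \<epsilon> where \<epsilon>: "\<epsilon> > 0" "ball c \<epsilon> \<subseteq> ?S"
    using c by (auto elim!: openE[of _ c])
  have "solves_system \<mu> (\<lambda>z. u (z + \<gamma>) + (-1) * u z) (\<lambda>z. v (z + \<gamma>) + (-1) * v z)"
    by (intro solves_system_lincomb solves_system_translate sol)
  moreover have "u (z + \<gamma>) + (-1) * u z = 0 \<and> v (z + \<gamma>) + (-1) * v z = 0" if "z \<in> ball c \<epsilon>" for z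
    using pm[of z] \<epsilon>(2) that by auto
  ultimately have "u (z + \<gamma>) + (-1) * u z = 0 \<and> v (z + \<gamma>) + (-1) * v z = 0" for z
    using solves_system_unique_continuation[OF _ \<epsilon>(1)] by blast
  then show "\<forall>z. u (z + \<gamma>) = u z \<and> v (z + \<gamma>) = v z" by simp
qed

section \<open>Fourier analysis on a lattice cell\<close>

text \<open>Lattice coordinates scaled so that translation by \<open>g\<close> or \<open>h\<close>
  raises one coordinate by 2 pi, the period of the one-variable results.\<close>

definition cell_point :: "complex \<Rightarrow> complex \<Rightarrow> real \<Rightarrow> real \<Rightarrow> complex" where
  "cell_point g h s t = (of_real s * g + of_real t * h) / of_real (2 * pi)"

definition cell_integral :: "complex \<Rightarrow> complex \<Rightarrow> (complex \<Rightarrow> complex) \<Rightarrow> complex" where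
  "cell_integral g h f = integral {0..2 * pi} (\<lambda>t. integral {0..2 * pi}
     (\<lambda>s. f (cell_point g h s t)))"

lemma continuous_on_cell:
  fixes f :: "complex \<Rightarrow> complex"
  assumes "continuous_on UNIV f"
  shows "continuous_on A (\<lambda>s. f (cell_point g h s t))"
    and "continuous_on A (\<lambda>t. f (cell_point g h s t))"
    and "continuous_on B (\<lambda>(t, s). f (cell_point g h s t))"
  unfolding split_beta cell_point_def
  by (rule continuous_on_compose2[OF assms], intro continuous_intros, simp, simp)+

lemma cell_integrable:
  fixes f :: "complex \<Rightarrow> complex"
  assumes "continuous_on UNIV f"
  shows "(\<lambda>s. f (cell_point g h s t)) integrable_on {0..2 * pi}"
    and "(\<lambda>t. integral {0..2 * pi} (\<lambda>s. f (cell_point g h s t))) integrable_on {0..2 * pi}"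
proof -
  show "(\<lambda>s. f (cell_point g h s t)) integrable_on {0..2 * pi}"
    by (intro integrable_continuous_real continuous_on_cell assms)
  have "continuous_on {0..2*pi} (\<lambda>t. integral (cbox 0 (2 * pi)) (\<lambda>s. f (cell_point g h s t)))"
    by (rule integral_continuous_on_param) (rule continuous_on_cell[OF assms])
  then show "(\<lambda>t. integral {0..2 * pi} (\<lambda>s. f (cell_point g h s t))) integrable_on {0..2 * pi}"
    by (intro integrable_continuous_real) simp
qed

lemma cell_integral_add:
  assumes "continuous_on UNIV f" "continuous_on UNIV f'"
  shows "cell_integral g h (\<lambda>z. f z + f' z) = cell_integral g h f + cell_integral g h f'"
  unfolding cell_integral_def
  by (simp add: integral_add cell_integrable assms)

lemma cell_integral_cmult: "cell_integral g h (\<lambda>z. c * f z) = c * cell_integral g h f"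
  unfolding cell_integral_def by simp

lemma cell_integral_sum:
  assumes "finite S" "\<And>i. i \<in> S \<Longrightarrow> continuous_on UNIV (f i)"
  shows "cell_integral g h (\<lambda>z. \<Sum>i\<in>S. f i z) = (\<Sum>i\<in>S. cell_integral g h (f i))"
  using assms
proof (induction S rule: finite_induct)
  case empty
  then show ?case by (simp add: cell_integral_def)
next
  case (insert x S)
  then show ?case by (simp add: cell_integral_add continuous_on_sum)
qed

lemma cell_integral_const: "cell_integral g h (\<lambda>z. c) = (of_real (2 * pi))\<^sup>2 * c"
  by (simp add: cell_integral_def power2_eq_square scaleR_conv_of_real)

text \<open>The derivative in direction \<open>g\<close> or \<open>h\<close> integrates to zero
  along a full period. Both are real combinations of \<open>P\<close> and \<open>Q\<close> with
  nonzero determinant, so the integrals of \<open>P\<close> and \<open>Q\<close> vanish too.\<close>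

lemma cell_integral_partials:
  assumes F: "has_partials F P Q" and per: "\<And>z. F (z + g) = F z" "\<And>z. F (z + h) = F z"
    and indep: "Re g * Im h - Im g * Re h \<noteq> 0"
  shows "cell_integral g h P = 0" "cell_integral g h Q = 0"
proof -
  have cont: "continuous_on A P" "continuous_on A Q" for A
    using F unfolding has_partials_def by (auto intro: continuous_on_subset)
  have edge: "integral {0..2 * pi} (\<lambda>s. of_real (Re w) * P (c + of_real s * w / of_real (2 * pi)) +
      of_real (Im w) * Q (c + of_real s * w / of_real (2 * pi))) = 0"
    if "\<And>z. F (z + w) = F z" for w c
  proof -
    have "((\<lambda>s. of_real (1 / (2 * pi)) * (of_real (Re w) * P (c + of_real s * w / of_real (2 * pi)) +
      of_real (Im w) * Q (c + of_real s * w / of_real (2 * pi)))) has_integral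
      F (c + of_real (2 * pi) * w / of_real (2 * pi)) - F (c + of_real 0 * w / of_real (2 * pi))) {0..2*pi}"
    proof (rule fundamental_theorem_of_calculus)
      fix s :: real
      have "((\<lambda>s. c + of_real s * w / of_real (2 * pi)) has_vector_derivative of_real (1 / (2 * pi)) * w) (at s within {0..2*pi})"
        unfolding has_vector_derivative_def by (auto intro!: derivative_eq_intros simp: scaleR_conv_of_real)
      from has_vector_derivative_along[OF F this]
      show "((\<lambda>s. F (c + of_real s * w / of_real (2 * pi))) has_vector_derivative
        of_real (1 / (2 * pi)) * (of_real (Re w) * P (c + of_real s * w / of_real (2 * pi)) +
        of_real (Im w) * Q (c + of_real s * w / of_real (2 * pi)))) (at s within {0..2*pi})"
        by (rule has_vector_derivative_eq_rhs) (simp add: field_simps)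
    qed simp
    also have "F (c + of_real (2 * pi) * w / of_real (2 * pi)) - F (c + of_real 0 * w / of_real (2 * pi)) = 0"
      using that[of c] by simp
    finally have "integral {0..2 * pi} (\<lambda>s. of_real (1 / (2 * pi)) * (of_real (Re w) * P (c + of_real s * w / of_real (2 * pi)) +
      of_real (Im w) * Q (c + of_real s * w / of_real (2 * pi)))) = 0" by (rule integral_unique)
    then show ?thesis unfolding integral_mult_right by simp
  qed
  define DD where "DD w z = of_real (Re w) * P z + of_real (Im w) * Q z" for w z
  have cD: "continuous_on UNIV (DD w)" for w
    unfolding DD_def by (intro continuous_intros cont)
  have L: "cell_integral g h (DD w) = of_real (Re w) * cell_integral g h P + of_real (Im w) * cell_integral g h Q" for w
    unfolding DD_def by (subst cell_integral_add) (intro continuous_intros cont cell_integral_cmult arg_cong2[of _ _ _ _ "(+)"])+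
  have "cell_integral g h (DD g) = 0"
  proof -
    have "integral {0..2 * pi} (\<lambda>s. DD g (cell_point g h s t)) = 0" for t
      using edge[OF per(1), of "of_real t * h / of_real (2 * pi)"]
      unfolding DD_def cell_point_def by (simp add: add_divide_distrib add.commute)
    then show ?thesis by (simp add: cell_integral_def)
  qed
  moreover have "cell_integral g h (DD h) = 0"
  proof -
    have "integral {0..2 * pi} (\<lambda>t. DD h (cell_point g h s t)) = 0" for s
      using edge[OF per(2), of "of_real s * g / of_real (2 * pi)"]
      unfolding DD_def cell_point_def by (simp add: add_divide_distrib add.commute)
    \<comment> \<open>Exchanging the integrals puts the \<open>h\<close> direction inside, where the
      period argument applies.\<close>
    moreover have "cell_integral g h (DD h) = integral {0..2 * pi} (\<lambda>s. integral {0..2 * pi}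
        (\<lambda>t. DD h (cell_point g h s t)))"
      unfolding cell_integral_def cbox_interval[symmetric]
      by (rule integral_swap_continuous) (rule continuous_on_cell[OF cD])
    ultimately show ?thesis by simp
  qed
  ultimately have
    e1: "of_real (Re g) * cell_integral g h P + of_real (Im g) * cell_integral g h Q = 0" and
    e2: "of_real (Re h) * cell_integral g h P + of_real (Im h) * cell_integral g h Q = 0"
    unfolding L by auto
  have D: "complex_of_real (Re g * Im h - Im g * Re h) \<noteq> 0"
    using indep unfolding of_real_eq_0_iff .
  have "of_real (Re g * Im h - Im g * Re h) * cell_integral g h P = 0"
    "of_real (Re g * Im h - Im g * Re h) * cell_integral g h Q = 0"
    using e1 e2 unfolding of_real_diff of_real_mult by algebra+
  then show "cell_integral g h P = 0" "cell_integral g h Q = 0"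
    using D by (metis mult_eq_0_iff)+
qed

lemma has_partials_times_cis:
  assumes "has_partials u p q"
  shows "has_partials (\<lambda>z. u z * cis (inner \<xi> z))
     (\<lambda>z. p z * cis (inner \<xi> z) + \<i> * of_real (Re \<xi>) * (u z * cis (inner \<xi> z)))
     (\<lambda>z. q z * cis (inner \<xi> z) + \<i> * of_real (Im \<xi>) * (u z * cis (inner \<xi> z)))"
proof -
  have "((\<lambda>z. u z * cis (inner \<xi> z)) has_derivative
     (\<lambda>v. of_real (Re v) * (p z * cis (inner \<xi> z) + \<i> * of_real (Re \<xi>) * (u z * cis (inner \<xi> z))) +
       of_real (Im v) * (q z * cis (inner \<xi> z) + \<i> * of_real (Im \<xi>) * (u z * cis (inner \<xi> z))))) (at z)" for z
  proof -
    have 1: "(u has_derivative (\<lambda>v. of_real (Re v) * p z + of_real (Im v) * q z)) (at z)"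
      using assms unfolding has_partials_def by blast
    have 2: "((\<lambda>z. cis (inner \<xi> z)) has_derivative (\<lambda>v. inner \<xi> v *\<^sub>R (\<i> * cis (inner \<xi> z)))) (at z)"
      by (intro has_derivative_cis has_derivative_inner_right has_derivative_ident)
    show ?thesis
      by (rule has_derivative_eq_rhs[OF has_derivative_mult[OF 1 2]])
        (auto simp: inner_complex_def scaleR_conv_of_real algebra_simps)
  qed
  moreover have "continuous_on UNIV u" using assms by (rule has_partials_continuous)
  ultimately show ?thesis
    using assms unfolding has_partials_def by (intro conjI allI continuous_intros) auto
qed

text \<open>One-variable uniqueness is used twice: first in \<open>t\<close>, for the Fourier
  coefficient taken in \<open>s\<close>, then in \<open>s\<close> itself. The functions
  \<open>\<phi> m n\<close> stand for pairings with dual lattice vectors.\<close>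

lemma cell_integral_eq_0_imp_zero:
  assumes cont: "continuous_on UNIV F" and per: "\<And>z. F (z + g) = F z" "\<And>z. F (z + h) = F z"
    and null: "\<And>m n :: int. cell_integral g h (\<lambda>z. F z * cis (\<phi> m n z)) = 0"
    and \<phi>: "\<And>m n s t. \<phi> m n (cell_point g h s t) = of_int m * s + of_int n * t"
  shows "F (cell_point g h s t) = 0"
proof -
  have inner_zero: "integral {0..2 * pi} (\<lambda>s. F (cell_point g h s t) * cis (of_int m * s)) = 0"
    (is "?G m t = 0") for m t
  proof (rule fourier_null_imp_zero[of "?G m"])
    show "fourier_null (?G m)"
      unfolding fourier_null_def
    proof (intro conjI allI)
      have "continuous_on UNIV (\<lambda>t. integral (cbox 0 (2 * pi)) (\<lambda>s. F (cell_point g h s t) * cis (of_int m * s)))"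
        using continuous_on_cell(3)[OF cont]
        by (intro integral_continuous_on_param) (auto simp: split_beta intro!: continuous_intros)
      then show "continuous_on UNIV (?G m)" by simp
      fix n
      show "integral {0..2 * pi} (\<lambda>t. ?G m t * cis (of_int n * t)) = 0"
        using null[of m n] unfolding cell_integral_def \<phi> cis_mult[symmetric]
        by (simp add: mult.assoc[symmetric])
    qed
  next
    fix t
    have "cell_point g h s (t + 2 * pi) = cell_point g h s t + h" for s
      by (simp add: cell_point_def field_simps)
    then show "?G m (t + 2 * pi) = ?G m t" by (simp only: per)
  qed
  show ?thesis
  proof (rule fourier_null_imp_zero[of "\<lambda>s. F (cell_point g h s t)"])
    show "fourier_null (\<lambda>s. F (cell_point g h s t))"
      unfolding fourier_null_def using continuous_on_cell(1)[OF cont] inner_zero by blast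
    fix s
    have "cell_point g h (s + 2 * pi) t = cell_point g h s t + g"
      by (simp add: cell_point_def field_simps)
    then show "F (cell_point g h (s + 2 * pi) t) =
        F (cell_point g h s t)" by (simp only: per)
  qed
qed

section \<open>Lattice bases and the dual lattice\<close>

lemma lattice_basis:
  assumes "is_lattice \<Gamma>"
  obtains g h where "\<Gamma> = {of_int m * g + of_int n * h | m n. True}" "Re g * Im h - Im g * Re h \<noteq> 0"
proof -
  obtain g h where gh: "g \<noteq> h" "independent {g, h}"
    and \<Gamma>: "\<Gamma> = {of_int m * g + of_int n * h | m n. True}"
    using assms unfolding is_lattice_def by blast
  have "Re g * Im h - Im g * Re h \<noteq> 0"
  proof
    assume D: "Re g * Im h - Im g * Re h = 0"
    have "dim {g, h} = DIM(complex)"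
      using gh by (simp add: dim_eq_card_independent)
    then have span: "span {g, h} = UNIV"
      using dim_eq_full by blast
    \<comment> \<open>With zero determinant, \<open>g\<close> rotated by a right angle is orthogonal
      to both generators, hence to the whole plane, including itself.\<close>
    have "{g, h} \<subseteq> {v. inner (\<i> * g) v = 0}"
      using D by (auto simp: inner_complex_def algebra_simps)
    then have "span {g, h} \<subseteq> {v. inner (\<i> * g) v = 0}"
      by (rule span_minimal) (rule subspace_hyperplane)
    then have "inner (\<i> * g) (\<i> * g) = 0" using span by blast
    then have "g = 0" by simp
    then show False using gh(2) dependent_zero by blast
  qed
  with \<Gamma> that show thesis by blast
qed

text \<open>Cramer's rule. It supplies dual lattice vectors with prescribed integer pairings, both
  for the full spectrum and for a given choice of signs.\<close>

lemma inner_basis_surj: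
  assumes "Re g * Im h - Im g * Re h \<noteq> 0"
  obtains \<xi> :: complex where "inner \<xi> g = \<alpha>" "inner \<xi> h = \<beta>"
proof
  define D where "D = Re g * Im h - Im g * Re h"
  have D: "D \<noteq> 0" using assms by (simp add: D_def)
  let ?\<xi> = "Complex ((\<alpha> * Im h - \<beta> * Im g) / D) ((\<beta> * Re g - \<alpha> * Re h) / D)"
  have "inner ?\<xi> g = \<alpha> * D / D" "inner ?\<xi> h = \<beta> * D / D"
    unfolding inner_complex_def complex.sel times_divide_eq_left add_divide_distrib[symmetric] inner_real_def
    by (rule arg_cong2[of _ _ _ _ "(/)"]; simp add: D_def algebra_simps)+
  then show "inner ?\<xi> g = \<alpha>" "inner ?\<xi> h = \<beta>" using D by simp_all
qed

lemma cell_point_surj: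
  assumes "Re g * Im h - Im g * Re h \<noteq> 0"
  obtains s t where "z = cell_point g h s t"
proof
  define D where "D = Re g * Im h - Im g * Re h"
  have D: "D \<noteq> 0" using assms by (simp add: D_def)
  define a where "a = (Re z * Im h - Im z * Re h) / D"
  define b where "b = (Re g * Im z - Im g * Re z) / D"
  have "a * D = Re z * Im h - Im z * Re h" "b * D = Re g * Im z - Im g * Re z"
    using D by (simp_all add: a_def b_def)
  then have "D * (a * Re g + b * Re h) = D * Re z" "D * (a * Im g + b * Im h) = D * Im z"
    unfolding D_def by algebra+
  then have "z = of_real a * g + of_real b * h"
    using D by (simp add: complex_eq_iff)
  then show "z = cell_point g h (2 * pi * a) (2 * pi * b)"
    by (simp add: cell_point_def field_simps)
qed

lemma mem_dual_lattice_iff: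
  assumes "\<Gamma> = {of_int m * g + of_int n * h | m n. True}"
  shows "\<omega> \<in> dual_lattice \<Gamma> \<longleftrightarrow> (\<exists>m n :: int. inner \<omega> g = 2 * pi * of_int m \<and> inner \<omega> h = 2 * pi * of_int n)"
proof
  assume *: "\<omega> \<in> dual_lattice \<Gamma>"
  have "g = of_int 1 * g + of_int 0 * h" "h = of_int 0 * g + of_int 1 * h"
    by simp_all
  then have "g \<in> \<Gamma>" "h \<in> \<Gamma>" unfolding assms by blast+
  with * show "\<exists>m n :: int. inner \<omega> g = 2 * pi * of_int m \<and> inner \<omega> h = 2 * pi * of_int n"
    unfolding dual_lattice_def by blast
next
  assume "\<exists>m n :: int. inner \<omega> g = 2 * pi * of_int m \<and> inner \<omega> h = 2 * pi * of_int n"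
  then obtain m n :: int where mn: "inner \<omega> g = 2 * pi * of_int m" "inner \<omega> h = 2 * pi * of_int n" by blast
  have "inner \<omega> (of_int k * g + of_int l * h) = 2 * pi * of_int (k * m + l * n)" for k l :: int
  proof -
    have "inner \<omega> (of_int k * g + of_int l * h) = inner \<omega> (of_int k *\<^sub>R g + of_int l *\<^sub>R h)"
      by (simp add: scaleR_conv_of_real)
    also have "\<dots> = 2 * pi * of_int (k * m + l * n)"
      unfolding inner_add_right inner_scaleR_right mn by (simp add: algebra_simps)
    finally show ?thesis .
  qed
  then show "\<omega> \<in> dual_lattice \<Gamma>"
    unfolding dual_lattice_def assms by blast
qed

lemma dual_lattice_uminus: "\<omega> \<in> dual_lattice \<Gamma> \<Longrightarrow> - \<omega> \<in> dual_lattice \<Gamma>"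
  unfolding dual_lattice_def by (auto simp: inner_minus_left) (metis mult_minus_right of_int_minus)

lemma dual_lattice_add: "\<omega> \<in> dual_lattice \<Gamma> \<Longrightarrow> \<omega>' \<in> dual_lattice \<Gamma> \<Longrightarrow> \<omega> + \<omega>' \<in> dual_lattice \<Gamma>"
  unfolding dual_lattice_def inner_add_left mem_Collect_eq by (metis distrib_left of_int_add)

lemma cis_dual_lattice:
  assumes "\<omega> \<in> dual_lattice \<Gamma>" "\<gamma> \<in> \<Gamma>"
  shows "cis (inner \<omega> \<gamma>) = 1"
proof -
  obtain n :: int where "inner \<omega> \<gamma> = 2 * pi * of_int n"
    using assms unfolding dual_lattice_def by blast
  then show ?thesis by (simp add: cis_multiple_2pi)
qed

text \<open>The square of this value is the character of \<open>\<omega>\<close> itself, which is 1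
  on the lattice.\<close>

lemma cis_half_dual_lattice:
  assumes "\<omega> \<in> dual_lattice \<Gamma>" "\<gamma> \<in> \<Gamma>"
  shows "cis (inner (\<omega> / 2) \<gamma>) = 1 \<or> cis (inner (\<omega> / 2) \<gamma>) = -1"
proof -
  have "inner (\<omega> / 2) \<gamma> + inner (\<omega> / 2) \<gamma> = inner \<omega> \<gamma>"
    by (simp flip: inner_add_left)
  then have "(cis (inner (\<omega> / 2) \<gamma>))\<^sup>2 = 1"
    using cis_dual_lattice[OF assms] by (simp add: power2_eq_square cis_mult)
  then show ?thesis by (simp add: power2_eq_1_iff)
qed

section \<open>Characters, Fourier coefficients of solutions, and plane waves\<close>

lemma has_partials_const: "has_partials (\<lambda>z. c) (\<lambda>z. 0) (\<lambda>z. 0)"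
  unfolding has_partials_def by simp

text \<open>The partial derivatives of the character are its multiples by i Re(omega) and i
  Im(omega). Both integrate to zero over a cell, and one of the factors is nonzero.\<close>

lemma cell_integral_character:
  assumes "cis (inner \<omega> g) = 1" "cis (inner \<omega> h) = 1" "\<omega> \<noteq> 0"
    and "Re g * Im h - Im g * Re h \<noteq> 0"
  shows "cell_integral g h (\<lambda>z. cis (inner \<omega> z)) = 0"
proof -
  have "has_partials (\<lambda>z. cis (inner \<omega> z)) (\<lambda>z. \<i> * of_real (Re \<omega>) * cis (inner \<omega> z)) (\<lambda>z. \<i> * of_real (Im \<omega>) * cis (inner \<omega> z))"
    using has_partials_times_cis[OF has_partials_const[of 1], of \<omega>] by simp
  from cell_integral_partials[OF this _ _ assms(4)] assms(1,2)
  have "\<i> * of_real (Re \<omega>) * cell_integral g h (\<lambda>z. cis (inner \<omega> z)) = 0"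
       "\<i> * of_real (Im \<omega>) * cell_integral g h (\<lambda>z. cis (inner \<omega> z)) = 0"
    unfolding cell_integral_cmult by (simp_all add: inner_add_right flip: cis_mult)
  then show ?thesis using assms(3) by (auto simp: complex_eq_iff)
qed

lemma cell_integral_lincomb:
  assumes "continuous_on UNIV f" "continuous_on UNIV f'"
  shows "cell_integral g h (\<lambda>z. f z + c * f' z) = cell_integral g h f + c * cell_integral g h f'"
  using assms by (simp add: cell_integral_add cell_integral_cmult continuous_on_mult continuous_on_const)

text \<open>Multiplication by \<open>cis (inner (- \<xi>) z)\<close> cancels the quasi-periodicity,
  so integration by parts turns the partial derivatives into factors i Re(xi) and i Im(xi). Then p -
  i q contributes i cnj xi and p' + i q' contributes i xi.\<close>

lemma solves_system_coefficients:
  assumes sol: "solves_system \<mu> u v"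
    and per: "\<And>z w. w \<in> {g, h} \<Longrightarrow> u (z + w) = cis (inner \<xi> w) * u z"
      "\<And>z w. w \<in> {g, h} \<Longrightarrow> v (z + w) = cis (inner \<xi> w) * v z"
    and indep: "Re g * Im h - Im g * Re h \<noteq> 0"
  defines "U \<equiv> cell_integral g h (\<lambda>z. u z * cis (inner (- \<xi>) z))"
    and "V \<equiv> cell_integral g h (\<lambda>z. v z * cis (inner (- \<xi>) z))"
  shows "cnj \<xi> * U = - of_real \<mu> * V" "\<xi> * V = - of_real \<mu> * U"
proof -
  obtain p q p' q' where pq: "has_partials u p q" "has_partials v p' q'"
    and eq: "\<And>z. p z - \<i> * q z = - \<i> * of_real \<mu> * v z" "\<And>z. p' z + \<i> * q' z = - \<i> * of_real \<mu> * u z"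
    using sol unfolding solves_system_iff_partials by blast
  have cE: "continuous_on UNIV (\<lambda>z. cis (inner (- \<xi>) z))"
    by (intro continuous_intros)
  \<comment> \<open>Stated for a general function because it is used once for each component of the
    solution.\<close>
  have coeff: "cell_integral g h (\<lambda>z. p z * cis (inner (- \<xi>) z)) = \<i> * of_real (Re \<xi>) * cell_integral g h (\<lambda>z. u z * cis (inner (- \<xi>) z))"
    "cell_integral g h (\<lambda>z. q z * cis (inner (- \<xi>) z)) = \<i> * of_real (Im \<xi>) * cell_integral g h (\<lambda>z. u z * cis (inner (- \<xi>) z))"
    if P: "has_partials u p q" and per: "\<And>z w. w \<in> {g, h} \<Longrightarrow> u (z + w) = cis (inner \<xi> w) * u z" for u p q
  proof -
    have c: "continuous_on UNIV p" "continuous_on UNIV q" "continuous_on UNIV u"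
      using P has_partials_continuous[OF P] unfolding has_partials_def by auto
    have "u (z + w) * cis (inner (- \<xi>) (z + w)) = u z * cis (inner (- \<xi>) z)" if "w \<in> {g, h}" for z w
    proof -
      have "u (z + w) * cis (inner (- \<xi>) (z + w)) = u z * (cis (inner \<xi> w) * cis (inner (- \<xi>) (z + w)))"
        using per[OF that] by simp
      also have "cis (inner \<xi> w) * cis (inner (- \<xi>) (z + w)) = cis (inner (- \<xi>) z)"
        by (simp add: cis_mult inner_add_right)
      finally show ?thesis .
    qed
    note 0 = cell_integral_partials[OF has_partials_times_cis[OF P, of "- \<xi>"] this this indep, simplified insert_iff simp_thms]
    show "cell_integral g h (\<lambda>z. p z * cis (inner (- \<xi>) z)) = \<i> * of_real (Re \<xi>) * cell_integral g h (\<lambda>z. u z * cis (inner (- \<xi>) z))"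
      "cell_integral g h (\<lambda>z. q z * cis (inner (- \<xi>) z)) = \<i> * of_real (Im \<xi>) * cell_integral g h (\<lambda>z. u z * cis (inner (- \<xi>) z))"
      using 0[unfolded cell_integral_lincomb[OF continuous_on_mult[OF c(1) cE] continuous_on_mult[OF c(3) cE]]
          cell_integral_lincomb[OF continuous_on_mult[OF c(2) cE] continuous_on_mult[OF c(3) cE]]]
      by (simp_all add: add_eq_0_iff2)
  qed
  have c: "continuous_on UNIV (\<lambda>z. p z * cis (inner (- \<xi>) z))" "continuous_on UNIV (\<lambda>z. q z * cis (inner (- \<xi>) z))"
    "continuous_on UNIV (\<lambda>z. p' z * cis (inner (- \<xi>) z))" "continuous_on UNIV (\<lambda>z. q' z * cis (inner (- \<xi>) z))"
    using pq cE unfolding has_partials_def by (auto intro!: continuous_on_mult)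
  have "- \<i> * of_real \<mu> * V = cell_integral g h (\<lambda>z. p z * cis (inner (- \<xi>) z) + (- \<i>) * (q z * cis (inner (- \<xi>) z)))"
    unfolding V_def cell_integral_cmult[symmetric]
  proof (rule arg_cong[of _ _ "cell_integral g h"], rule ext)
    fix z
    show "- \<i> * of_real \<mu> * (v z * cis (inner (- \<xi>) z)) = p z * cis (inner (- \<xi>) z) + (- \<i>) * (q z * cis (inner (- \<xi>) z))" using arg_cong[OF eq(1)[of z], of "\<lambda>x. x * cis (inner (- \<xi>) z)"] by (simp add: algebra_simps)
  qed
  also have "\<dots> = (\<i> * of_real (Re \<xi>) + of_real (Im \<xi>)) * U"
    using coeff[OF pq(1) per(1)] unfolding cell_integral_lincomb[OF c(1) c(2)] U_def
    by (simp add: algebra_simps)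
  also have "\<i> * of_real (Re \<xi>) + of_real (Im \<xi>) = \<i> * cnj \<xi>" by (simp add: complex_eq_iff)
  finally have "\<i> * (- of_real \<mu> * V) = \<i> * (cnj \<xi> * U)" by (simp add: algebra_simps)
  then show "cnj \<xi> * U = - of_real \<mu> * V" unfolding mult_cancel_left by simp
  have "- \<i> * of_real \<mu> * U = cell_integral g h (\<lambda>z. p' z * cis (inner (- \<xi>) z) + \<i> * (q' z * cis (inner (- \<xi>) z)))"
    unfolding U_def cell_integral_cmult[symmetric]
  proof (rule arg_cong[of _ _ "cell_integral g h"], rule ext)
    fix z
    show "- \<i> * of_real \<mu> * (u z * cis (inner (- \<xi>) z)) = p' z * cis (inner (- \<xi>) z) + \<i> * (q' z * cis (inner (- \<xi>) z))" using arg_cong[OF eq(2)[of z], of "\<lambda>x. x * cis (inner (- \<xi>) z)"] by (simp add: algebra_simps)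
  qed
  also have "\<dots> = (\<i> * of_real (Re \<xi>) - of_real (Im \<xi>)) * V"
    using coeff[OF pq(2) per(2)] unfolding cell_integral_lincomb[OF c(3) c(4)] V_def
    by (simp add: algebra_simps)
  also have "\<i> * of_real (Re \<xi>) - of_real (Im \<xi>) = \<i> * \<xi>" by (simp add: complex_eq_iff)
  finally have "\<i> * (- of_real \<mu> * U) = \<i> * (\<xi> * V)" by (simp add: algebra_simps)
  then show "\<xi> * V = - of_real \<mu> * U" unfolding mult_cancel_left by simp
qed

text \<open>On the wave, 2 i \<open>d_z\<close> is multiplication by -cnj xi and 2 i
  \<open>d_zbar\<close> by -xi. The first equation dictates the second component; the second then
  amounts to xi * cnj xi = mu^2.\<close>

lemma solves_system_plane_wave:
  assumes "\<mu> \<noteq> 0" "(cmod \<xi>)\<^sup>2 = \<mu>\<^sup>2"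
  shows "solves_system \<mu> (\<lambda>z. a * cis (inner \<xi> z)) (\<lambda>z. - (1 / of_real \<mu> * a * cnj \<xi> * cis (inner \<xi> z)))"
  unfolding solves_system_iff_partials
proof (intro exI conjI allI)
  show "has_partials (\<lambda>z. a * cis (inner \<xi> z))
    (\<lambda>z. \<i> * of_real (Re \<xi>) * (a * cis (inner \<xi> z))) (\<lambda>z. \<i> * of_real (Im \<xi>) * (a * cis (inner \<xi> z)))" for a
    using has_partials_times_cis[OF has_partials_const[of a], of \<xi>] by simp
  from this[of "- (1 / of_real \<mu> * a * cnj \<xi>)"]
  show "has_partials (\<lambda>z. - (1 / of_real \<mu> * a * cnj \<xi> * cis (inner \<xi> z)))
    (\<lambda>z. \<i> * of_real (Re \<xi>) * (- (1 / of_real \<mu> * a * cnj \<xi>) * cis (inner \<xi> z)))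
    (\<lambda>z. \<i> * of_real (Im \<xi>) * (- (1 / of_real \<mu> * a * cnj \<xi>) * cis (inner \<xi> z)))" by simp
  fix z
  have m: "complex_of_real \<mu> \<noteq> 0" using assms by simp
  have 1: "of_real (Re \<xi>) - \<i> * of_real (Im \<xi>) = cnj \<xi>" "of_real (Re \<xi>) + \<i> * of_real (Im \<xi>) = \<xi>"
    by (simp_all add: complex_eq_iff)
  have 2: "\<xi> * cnj \<xi> = of_real \<mu> * of_real \<mu>"
    using assms(2) by (simp add: complex_norm_square[symmetric] power2_eq_square flip: of_real_mult)
  have lin: "\<i> * x * f - \<i> * (\<i> * y * f) = \<i> * ((x - \<i> * y) * f)"
    "\<i> * x * f + \<i> * (\<i> * y * f) = \<i> * ((x + \<i> * y) * f)" for x y f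
    by (simp_all add: algebra_simps)
  let ?e = "a * cis (inner \<xi> z)"
  have "\<i> * of_real (Re \<xi>) * ?e - \<i> * (\<i> * of_real (Im \<xi>) * ?e) = \<i> * ((of_real (Re \<xi>) - \<i> * of_real (Im \<xi>)) * ?e)"
    by (rule lin)
  also have "\<dots> = - \<i> * of_real \<mu> * - (1 / of_real \<mu> * a * cnj \<xi> * cis (inner \<xi> z))"
    using m by (simp add: 1)
  finally show "\<i> * of_real (Re \<xi>) * ?e - \<i> * (\<i> * of_real (Im \<xi>) * ?e) =
     - \<i> * of_real \<mu> * - (1 / of_real \<mu> * a * cnj \<xi> * cis (inner \<xi> z))" .
  let ?f = "- (1 / of_real \<mu> * a * cnj \<xi>) * cis (inner \<xi> z)"
  have "\<i> * of_real (Re \<xi>) * ?f + \<i> * (\<i> * of_real (Im \<xi>) * ?f) = \<i> * ((of_real (Re \<xi>) + \<i> * of_real (Im \<xi>)) * ?f)"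
    by (rule lin)
  also have "\<dots> = - \<i> * (1 / of_real \<mu>) * (\<xi> * cnj \<xi>) * ?e"
    by (simp add: 1)
  also have "\<dots> = - \<i> * of_real \<mu> * ?e"
    using m by (simp add: 2)
  finally show "\<i> * of_real (Re \<xi>) * ?f + \<i> * (\<i> * of_real (Im \<xi>) * ?f) = - \<i> * of_real \<mu> * ?e" .
qed

lemma solves_system_sum:
  assumes "finite S" "\<And>i. i \<in> S \<Longrightarrow> solves_system \<mu> (u i) (v i)"
  shows "solves_system \<mu> (\<lambda>z. \<Sum>i\<in>S. u i z) (\<lambda>z. \<Sum>i\<in>S. v i z)"
  using assms
proof (induction S rule: finite_induct)
  case empty
  have "solves_system \<mu> (\<lambda>z. 0) (\<lambda>z. 0)"
    unfolding solves_system_iff_partials using has_partials_const[of 0] by fastforce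
  then show ?case by simp
next
  case (insert i S)
  then have "solves_system \<mu> (\<lambda>z. u i z + 1 * (\<Sum>i\<in>S. u i z)) (\<lambda>z. v i z + 1 * (\<Sum>i\<in>S. v i z))"
    by (intro solves_system_lincomb) auto
  then show ?case using insert.hyps by simp
qed

section \<open>Solutions with doubly periodic form\<close>

text \<open>Dual lattice characters are trivial on the lattice, so every term picks up the same
  factor, that of \<open>\<omega>\<^sub>0\<close>.\<close>

lemma exponential_sum_quasiperiodic:
  assumes "\<And>z. u z = (\<Sum>\<omega>\<in>S. a \<omega> * cis (inner (\<omega> + \<omega>\<^sub>0) z))" "S \<subseteq> dual_lattice \<Gamma>" "\<gamma> \<in> \<Gamma>"
  shows "u (z + \<gamma>) = cis (inner \<omega>\<^sub>0 \<gamma>) * u z"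
proof -
  have "cis (inner (\<omega> + \<omega>\<^sub>0) (z + \<gamma>)) = cis (inner \<omega>\<^sub>0 \<gamma>) * cis (inner (\<omega> + \<omega>\<^sub>0) z)" if "\<omega> \<in> S" for \<omega>
  proof -
    have "cis (inner (\<omega> + \<omega>\<^sub>0) (z + \<gamma>)) = cis (inner (\<omega> + \<omega>\<^sub>0) z) * (cis (inner \<omega> \<gamma>) * cis (inner \<omega>\<^sub>0 \<gamma>))"
      by (simp add: cis_mult inner_add_left inner_add_right)
    also have "cis (inner \<omega> \<gamma>) = 1"
      using cis_dual_lattice that assms(2,3) by blast
    finally show ?thesis by (simp add: mult.commute)
  qed
  then show ?thesis
    unfolding assms(1) sum_distrib_left by (intro sum.cong) (auto simp: algebra_simps)
qed

text \<open>Needed twice: for the converse implication, and to make the difference between a given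
  solution and its candidate expansion a solution again.\<close>

lemma solution_of_exponential_sum:
  assumes "is_lattice \<Gamma>" "\<mu> \<noteq> 0" and S: "S = dual_lattice_circle \<Gamma> \<omega>\<^sub>0 \<mu>"
    and u: "\<And>z. u z = (\<Sum>\<omega>\<in>S. a \<omega> * cis (inner (\<omega> + \<omega>\<^sub>0) z))"
    and v: "\<And>z. v z = (\<Sum>\<omega>\<in>S. - (1 / of_real \<mu> * a \<omega> * cnj (\<omega> + \<omega>\<^sub>0)) * cis (inner (\<omega> + \<omega>\<^sub>0) z))"
  shows "solves_system \<mu> u v"
    and "\<gamma> \<in> \<Gamma> \<Longrightarrow> u (z + \<gamma>) = cis (inner \<omega>\<^sub>0 \<gamma>) * u z"
    and "\<gamma> \<in> \<Gamma> \<Longrightarrow> v (z + \<gamma>) = cis (inner \<omega>\<^sub>0 \<gamma>) * v z"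
proof -
  have fin: "finite S" unfolding S using assms(1) by (rule finite_dual_lattice_circle)
  have sub: "S \<subseteq> dual_lattice \<Gamma>" and circ: "\<And>\<omega>. \<omega> \<in> S \<Longrightarrow> (cmod (\<omega> + \<omega>\<^sub>0))\<^sup>2 = \<mu>\<^sup>2"
    by (auto simp: S dual_lattice_circle_def)
  have "solves_system \<mu> (\<lambda>z. \<Sum>\<omega>\<in>S. a \<omega> * cis (inner (\<omega> + \<omega>\<^sub>0) z))
     (\<lambda>z. \<Sum>\<omega>\<in>S. - (1 / of_real \<mu> * a \<omega> * cnj (\<omega> + \<omega>\<^sub>0) * cis (inner (\<omega> + \<omega>\<^sub>0) z)))"
    by (intro solves_system_sum fin solves_system_plane_wave assms(2) circ)
  moreover have "u = (\<lambda>z. \<Sum>\<omega>\<in>S. a \<omega> * cis (inner (\<omega> + \<omega>\<^sub>0) z))" using u by blast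
  moreover have "v = (\<lambda>z. \<Sum>\<omega>\<in>S. - (1 / of_real \<mu> * a \<omega> * cnj (\<omega> + \<omega>\<^sub>0) * cis (inner (\<omega> + \<omega>\<^sub>0) z)))"
    by (rule ext) (simp add: v)
  ultimately show "solves_system \<mu> u v" by simp
  show "\<gamma> \<in> \<Gamma> \<Longrightarrow> u (z + \<gamma>) = cis (inner \<omega>\<^sub>0 \<gamma>) * u z"
    by (rule exponential_sum_quasiperiodic[OF u sub])
  show "\<gamma> \<in> \<Gamma> \<Longrightarrow> v (z + \<gamma>) = cis (inner \<omega>\<^sub>0 \<gamma>) * v z"
    by (rule exponential_sum_quasiperiodic[OF v sub])
qed

text \<open>Removing the factor of \<open>\<omega>\<^sub>0\<close> makes \<open>f\<close> periodic.
  The dual vectors \<open>W m n\<close> pair with \<open>g\<close> and \<open>h\<close> to 2 pi m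
  and 2 pi n, so they become the integer frequencies in cell coordinates.\<close>

lemma dual_lattice_spectrum_zero:
  assumes \<Gamma>: "\<Gamma> = {of_int m * g + of_int n * h | m n. True}" and indep: "Re g * Im h - Im g * Re h \<noteq> 0"
    and cont: "continuous_on UNIV f"
    and per: "\<And>z w. w \<in> {g, h} \<Longrightarrow> f (z + w) = cis (inner \<omega>\<^sub>0 w) * f z"
    and null: "\<And>\<omega>. \<omega> \<in> dual_lattice \<Gamma> \<Longrightarrow> cell_integral g h (\<lambda>z. f z * cis (inner (- (\<omega> + \<omega>\<^sub>0)) z)) = 0"
  shows "f z = 0"
proof -
  define F where "F z = f z * cis (inner (- \<omega>\<^sub>0) z)" for z
  have "\<forall>m n :: int. \<exists>\<omega>. inner \<omega> g = 2 * pi * of_int m \<and> inner \<omega> h = 2 * pi * of_int n"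
    using inner_basis_surj[OF indep] by metis
  then obtain W where W: "\<And>m n :: int. inner (W m n) g = 2 * pi * of_int m" "\<And>m n. inner (W m n) h = 2 * pi * of_int n"
    by metis
  obtain s t where z: "z = cell_point g h s t" using cell_point_surj[OF indep] .
  have perF: "F (z + w) = F z" if "w \<in> {g, h}" for z w
  proof -
    have "F (z + w) = f z * (cis (inner \<omega>\<^sub>0 w) * cis (inner (- \<omega>\<^sub>0) (z + w)))"
      unfolding F_def per[OF that] by simp
    also have "cis (inner \<omega>\<^sub>0 w) * cis (inner (- \<omega>\<^sub>0) (z + w)) = cis (inner (- \<omega>\<^sub>0) z)"
      by (simp add: cis_mult inner_add_right)
    finally show ?thesis by (simp add: F_def)
  qed
  have "F (cell_point g h s t) = 0"
  proof (rule cell_integral_eq_0_imp_zero[where \<phi> = "\<lambda>m n. inner (W m n)"])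
    show "continuous_on UNIV F" unfolding F_def by (intro continuous_intros cont)
    show "F (z + g) = F z" "F (z + h) = F z" for z using perF by simp_all
    show "cell_integral g h (\<lambda>z. F z * cis (inner (W m n) z)) = 0" for m n
    proof -
      have "W m n \<in> dual_lattice \<Gamma>" unfolding mem_dual_lattice_iff[OF \<Gamma>] using W by blast
      \<comment> \<open>The hypothesis has a negative exponent, so frequency \<open>W m n\<close>
        corresponds to the dual vector \<open>- W m n\<close>.\<close>
      from null[OF dual_lattice_uminus[OF this]] show ?thesis
        unfolding F_def mult.assoc cis_mult by (simp add: inner_add_left inner_diff_left inner_minus_left algebra_simps)
    qed
    show "inner (W m n) (cell_point g h s t) = of_int m * s + of_int n * t" for m n s t
    proof -
      have "cell_point g h s t = (s / (2 * pi)) *\<^sub>R g + (t / (2 * pi)) *\<^sub>R h"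
        by (simp add: cell_point_def scaleR_conv_of_real add_divide_distrib)
      then show ?thesis by (simp add: inner_add_right W)
    qed
  qed
  then show ?thesis by (simp add: F_def z)
qed

text \<open>No convergence question arises: the finite sum over the circle is subtracted, and the
  difference has zero coefficients, off the circle by the algebraic relations and on it by the
  choice of \<open>a\<close>.\<close>

theorem quasiperiodic_solution_expansion:
  assumes lat: "is_lattice \<Gamma>" and \<Gamma>: "\<Gamma> = {of_int m * g + of_int n * h | m n. True}"
    and indep: "Re g * Im h - Im g * Re h \<noteq> 0" and "\<mu> \<noteq> 0"
    and sol: "solves_system \<mu> u v"
    and per: "\<And>z w. w \<in> {g, h} \<Longrightarrow> u (z + w) = cis (inner \<omega>\<^sub>0 w) * u z"
      "\<And>z w. w \<in> {g, h} \<Longrightarrow> v (z + w) = cis (inner \<omega>\<^sub>0 w) * v z"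
  defines "S \<equiv> dual_lattice_circle \<Gamma> \<omega>\<^sub>0 \<mu>"
  obtains a where "\<And>z. u z = (\<Sum>\<omega>\<in>S. a \<omega> * cis (inner (\<omega> + \<omega>\<^sub>0) z))"
    "\<And>z. v z = (\<Sum>\<omega>\<in>S. - (1 / of_real \<mu> * a \<omega> * cnj (\<omega> + \<omega>\<^sub>0)) * cis (inner (\<omega> + \<omega>\<^sub>0) z))"
proof -
  have "g = of_int 1 * g + of_int 0 * h" "h = of_int 0 * g + of_int 1 * h"
    by simp_all
  then have gh: "g \<in> \<Gamma>" "h \<in> \<Gamma>" unfolding \<Gamma> by blast+
  have fin: "finite S" unfolding S_def using lat by (rule finite_dual_lattice_circle)
  \<comment> \<open>The divisor is the cell integral of 1 in the coordinates of
    \<open>cell_point\<close>.\<close>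
  define a where "a \<omega> = cell_integral g h (\<lambda>z. u z * cis (inner (- (\<omega> + \<omega>\<^sub>0)) z)) / (of_real (2 * pi))\<^sup>2" for \<omega>
  define u' where "u' z = (\<Sum>\<omega>\<in>S. a \<omega> * cis (inner (\<omega> + \<omega>\<^sub>0) z))" for z
  define v' where "v' z = (\<Sum>\<omega>\<in>S. - (1 / of_real \<mu> * a \<omega> * cnj (\<omega> + \<omega>\<^sub>0)) * cis (inner (\<omega> + \<omega>\<^sub>0) z))" for z
  note sol' = solution_of_exponential_sum[OF lat \<open>\<mu> \<noteq> 0\<close> S_def[THEN meta_eq_to_obj_eq] u'_def v'_def]
  define D where "D z = u z + (-1) * u' z" for z
  define D' where "D' z = v z + (-1) * v' z" for z
  have solD: "solves_system \<mu> D D'"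
    unfolding D_def D'_def by (intro solves_system_lincomb sol sol')
  have perD: "D (z + w) = cis (inner \<omega>\<^sub>0 w) * D z" "D' (z + w) = cis (inner \<omega>\<^sub>0 w) * D' z" if "w \<in> {g, h}" for z w
    using that gh per[OF that] sol'(2,3)[of w] by (auto simp: D_def D'_def right_diff_distrib)
  have contu: "continuous_on UNIV u" and contD: "continuous_on UNIV D" "continuous_on UNIV D'"
    using sol solD unfolding solves_system_iff_partials by (blast intro: has_partials_continuous)+
  have zero: "cell_integral g h (\<lambda>z. D z * cis (inner (- (\<omega> + \<omega>\<^sub>0)) z)) = 0 \<and>
      cell_integral g h (\<lambda>z. D' z * cis (inner (- (\<omega> + \<omega>\<^sub>0)) z)) = 0" if \<omega>: "\<omega> \<in> dual_lattice \<Gamma>" for \<omega>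
  proof -
    define U where "U = cell_integral g h (\<lambda>z. D z * cis (inner (- (\<omega> + \<omega>\<^sub>0)) z))"
    define V where "V = cell_integral g h (\<lambda>z. D' z * cis (inner (- (\<omega> + \<omega>\<^sub>0)) z))"
    have "cis (inner (\<omega> + \<omega>\<^sub>0) w) = cis (inner \<omega>\<^sub>0 w)" if "w \<in> {g, h}" for w
      using cis_dual_lattice[OF \<omega>, of w] gh that by (auto simp: inner_add_left simp flip: cis_mult)
    with perD have "D (z + w) = cis (inner (\<omega> + \<omega>\<^sub>0) w) * D z" "D' (z + w) = cis (inner (\<omega> + \<omega>\<^sub>0) w) * D' z"
      if "w \<in> {g, h}" for z w using that by simp_all
    note UV = solves_system_coefficients[OF solD this indep, folded U_def V_def]
    have "U = 0"
    proof (cases "\<omega> \<in> S")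
      case False
      then have "(cmod (\<omega> + \<omega>\<^sub>0))\<^sup>2 \<noteq> \<mu>\<^sup>2"
        using \<omega> by (auto simp: S_def dual_lattice_circle_def)
      then have "complex_of_real ((cmod (\<omega> + \<omega>\<^sub>0))\<^sup>2) \<noteq> of_real (\<mu>\<^sup>2)"
        unfolding of_real_eq_iff .
      then have ne: "(\<omega> + \<omega>\<^sub>0) * cnj (\<omega> + \<omega>\<^sub>0) \<noteq> of_real \<mu> * of_real \<mu>"
        unfolding complex_norm_square by (simp add: power2_eq_square)
      \<comment> \<open>The first relation multiplied by xi =
        \<open>\<omega> + \<omega>\<^sub>0\<close>, with the second inserted, gives xi * cnj xi * U
        = mu^2 * U.\<close>
      have "((\<omega> + \<omega>\<^sub>0) * cnj (\<omega> + \<omega>\<^sub>0) - of_real \<mu> * of_real \<mu>) * U = 0"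
        using UV by algebra
      with ne show ?thesis by simp
    next
      case True
      have "D z * cis (inner (- (\<omega> + \<omega>\<^sub>0)) z) = u z * cis (inner (- (\<omega> + \<omega>\<^sub>0)) z) +
          (-1) * (\<Sum>\<omega>'\<in>S. a \<omega>' * cis (inner (\<omega>' - \<omega>) z))" for z
      proof -
        have "cis (inner (\<omega>' + \<omega>\<^sub>0) z) * cis (inner (- (\<omega> + \<omega>\<^sub>0)) z) = cis (inner (\<omega>' - \<omega>) z)" for \<omega>'
          by (simp add: cis_mult flip: inner_add_left)
        then show ?thesis
          unfolding D_def u'_def distrib_right mult.assoc sum_distrib_right by simp
      qed
      then have "U = cell_integral g h (\<lambda>z. u z * cis (inner (- (\<omega> + \<omega>\<^sub>0)) z)) +
          (-1) * cell_integral g h (\<lambda>z. \<Sum>\<omega>'\<in>S. a \<omega>' * cis (inner (\<omega>' - \<omega>) z))"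
        unfolding U_def by (simp only:) (intro cell_integral_lincomb continuous_intros contu)
      also have "cell_integral g h (\<lambda>z. \<Sum>\<omega>'\<in>S. a \<omega>' * cis (inner (\<omega>' - \<omega>) z)) =
          (\<Sum>\<omega>'\<in>S. a \<omega>' * cell_integral g h (\<lambda>z. cis (inner (\<omega>' - \<omega>) z)))"
        by (subst cell_integral_sum[OF fin]) (intro continuous_intros, simp add: cell_integral_cmult)
      \<comment> \<open>Orthogonality of distinct characters leaves only the term of
        \<open>\<omega>\<close>.\<close>
      also have "\<dots> = (\<Sum>\<omega>'\<in>S. if \<omega>' = \<omega> then a \<omega> * (of_real (2 * pi))\<^sup>2 else 0)"
      proof (rule sum.cong[OF refl])
        fix \<omega>' assume "\<omega>' \<in> S"
        then have "\<omega>' + - \<omega> \<in> dual_lattice \<Gamma>"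
          using \<omega> by (intro dual_lattice_add dual_lattice_uminus) (auto simp: S_def dual_lattice_circle_def)
        then have "cis (inner (\<omega>' - \<omega>) g) = 1" "cis (inner (\<omega>' - \<omega>) h) = 1"
          using cis_dual_lattice gh by (metis diff_conv_add_uminus)+
        then show "a \<omega>' * cell_integral g h (\<lambda>z. cis (inner (\<omega>' - \<omega>) z)) = (if \<omega>' = \<omega> then a \<omega> * (of_real (2 * pi))\<^sup>2 else 0)"
          using cell_integral_character[OF _ _ _ indep, of "\<omega>' - \<omega>"] cell_integral_const[of g h 1] by auto
      qed
      also have "\<dots> = a \<omega> * (of_real (2 * pi))\<^sup>2"
        using True fin by simp
      finally show "U = 0" by (simp add: a_def)
    qed
    moreover from this UV(1) have "V = 0" using \<open>\<mu> \<noteq> 0\<close> by simp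
    ultimately show ?thesis by (simp add: U_def V_def)
  qed
  have "D z = 0" "D' z = 0" for z
    using dual_lattice_spectrum_zero[OF \<Gamma> indep contD(1) perD(1)]
      dual_lattice_spectrum_zero[OF \<Gamma> indep contD(2) perD(2)] zero by blast+
  then show thesis
    using that[of a] by (simp add: D_def D'_def u'_def v'_def)
qed

theorem lemma4:
  fixes \<Gamma> :: "complex set" and \<mu> :: real
    and lam :: "complex \<Rightarrow> quat" and lam\<^sub>1 lam\<^sub>2 :: "complex \<Rightarrow> complex"
  assumes "is_lattice \<Gamma>" and "\<mu> \<noteq> 0"
    and "\<And>z. lam z = quat_of_complex (lam\<^sub>1 z) + quat_j * quat_of_complex (lam\<^sub>2 z)"
  shows "solves_system \<mu> lam\<^sub>1 lam\<^sub>2 \<and> doubly_periodic_form \<Gamma> (df_form lam) \<longleftrightarrow>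
    (\<exists>\<omega>\<^sub>0 \<in> (\<lambda>\<omega>. \<omega> / 2) ` dual_lattice \<Gamma>. \<exists>a :: complex \<Rightarrow> complex. \<forall>z.
       lam\<^sub>1 z = (\<Sum>\<omega> \<in> dual_lattice_circle \<Gamma> \<omega>\<^sub>0 \<mu>.
         a \<omega> * exp (\<i> * of_real (inner (\<omega> + \<omega>\<^sub>0) z))) \<and>
       lam\<^sub>2 z = - (\<Sum>\<omega> \<in> dual_lattice_circle \<Gamma> \<omega>\<^sub>0 \<mu>.
         1 / of_real \<mu> * a \<omega> * (cnj \<omega> + cnj \<omega>\<^sub>0) * exp (\<i> * of_real (inner (\<omega> + \<omega>\<^sub>0) z))))"
    (is "?L \<longleftrightarrow> ?R")
proof
  assume ?L
  then have sol: "solves_system \<mu> lam\<^sub>1 lam\<^sub>2" and form: "doubly_periodic_form \<Gamma> (df_form lam)" by auto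
  obtain g h where \<Gamma>: "\<Gamma> = {of_int m * g + of_int n * h | m n. True}" and indep: "Re g * Im h - Im g * Re h \<noteq> 0"
    using lattice_basis[OF assms(1)] .
  have "g = of_int 1 * g + of_int 0 * h" "h = of_int 0 * g + of_int 1 * h"
    by simp_all
  then have gh: "g \<in> \<Gamma>" "h \<in> \<Gamma>" unfolding \<Gamma> by blast+
  \<comment> \<open>The sign is written as \<open>cis (of_int n * pi)\<close> because
    \<open>n * pi\<close> is the pairing that half a dual lattice vector can have.\<close>
  have sign: "\<exists>n::int. \<forall>z. lam\<^sub>1 (z + \<gamma>) = cis (of_int n * pi) * lam\<^sub>1 z \<and> lam\<^sub>2 (z + \<gamma>) = cis (of_int n * pi) * lam\<^sub>2 z"
    if "\<gamma> \<in> \<Gamma>" for \<gamma>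
  proof -
    have "(lam\<^sub>1 (z + \<gamma>) = lam\<^sub>1 z \<and> lam\<^sub>2 (z + \<gamma>) = lam\<^sub>2 z) \<or> (lam\<^sub>1 (z + \<gamma>) = - lam\<^sub>1 z \<and> lam\<^sub>2 (z + \<gamma>) = - lam\<^sub>2 z)" for z
      using form that df_form_eq_iff[of lam lam\<^sub>1 lam\<^sub>2 "z + \<gamma>" z, OF assms(3)]
      unfolding doubly_periodic_form_def by blast
    from global_sign_of_pointwise_sign[OF sol this] show ?thesis
    proof
      assume "\<forall>z. lam\<^sub>1 (z + \<gamma>) = lam\<^sub>1 z \<and> lam\<^sub>2 (z + \<gamma>) = lam\<^sub>2 z"
      then show ?thesis by (intro exI[of _ 0]) simp
    next
      assume "\<forall>z. lam\<^sub>1 (z + \<gamma>) = - lam\<^sub>1 z \<and> lam\<^sub>2 (z + \<gamma>) = - lam\<^sub>2 z"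
      then show ?thesis by (intro exI[of _ 1]) simp
    qed
  qed
  obtain m n :: int where
    m: "\<And>z. lam\<^sub>1 (z + g) = cis (of_int m * pi) * lam\<^sub>1 z \<and> lam\<^sub>2 (z + g) = cis (of_int m * pi) * lam\<^sub>2 z" and
    n: "\<And>z. lam\<^sub>1 (z + h) = cis (of_int n * pi) * lam\<^sub>1 z \<and> lam\<^sub>2 (z + h) = cis (of_int n * pi) * lam\<^sub>2 z"
    using sign[OF gh(1)] sign[OF gh(2)] by blast
  \<comment> \<open>Any pair of signs on the two generators is realised by a dual lattice vector,
    halved below to give \<open>\<omega>\<^sub>0\<close>.\<close>
  obtain \<omega> where \<omega>: "inner \<omega> g = 2 * pi * of_int m" "inner \<omega> h = 2 * pi * of_int n"
    using inner_basis_surj[OF indep] .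
  define \<omega>\<^sub>0 where "\<omega>\<^sub>0 = \<omega> / 2"
  have "\<omega>\<^sub>0 = (1 / 2) *\<^sub>R \<omega>" by (simp add: \<omega>\<^sub>0_def scaleR_conv_of_real)
  then have inner0: "inner \<omega>\<^sub>0 g = of_int m * pi" "inner \<omega>\<^sub>0 h = of_int n * pi"
    using \<omega> by simp_all
  have half: "\<omega>\<^sub>0 \<in> (\<lambda>\<omega>. \<omega> / 2) ` dual_lattice \<Gamma>"
    unfolding \<omega>\<^sub>0_def using \<omega> mem_dual_lattice_iff[OF \<Gamma>] by blast
  have per: "lam\<^sub>1 (z + w) = cis (inner \<omega>\<^sub>0 w) * lam\<^sub>1 z" "lam\<^sub>2 (z + w) = cis (inner \<omega>\<^sub>0 w) * lam\<^sub>2 z"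
    if "w \<in> {g, h}" for z w
    using that m n by (auto simp: inner0)
  obtain a where "\<And>z. lam\<^sub>1 z = (\<Sum>\<omega>\<in>dual_lattice_circle \<Gamma> \<omega>\<^sub>0 \<mu>. a \<omega> * cis (inner (\<omega> + \<omega>\<^sub>0) z))"
    "\<And>z. lam\<^sub>2 z = (\<Sum>\<omega>\<in>dual_lattice_circle \<Gamma> \<omega>\<^sub>0 \<mu>. - (1 / of_real \<mu> * a \<omega> * cnj (\<omega> + \<omega>\<^sub>0)) * cis (inner (\<omega> + \<omega>\<^sub>0) z))"
    using quasiperiodic_solution_expansion[OF assms(1) \<Gamma> indep assms(2) sol per] by blast
  then show ?R
    by (intro bexI[OF _ half] exI[of _ a]) (simp add: cis_conv_exp sum_negf)
next
  assume ?R
  then obtain \<omega> a where \<omega>: "\<omega> \<in> dual_lattice \<Gamma>" and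
    l1: "\<And>z. lam\<^sub>1 z = (\<Sum>\<omega>' \<in> dual_lattice_circle \<Gamma> (\<omega> / 2) \<mu>. a \<omega>' * cis (inner (\<omega>' + \<omega> / 2) z))" and
    "\<And>z. lam\<^sub>2 z = - (\<Sum>\<omega>' \<in> dual_lattice_circle \<Gamma> (\<omega> / 2) \<mu>.
         1 / of_real \<mu> * a \<omega>' * (cnj \<omega>' + cnj (\<omega> / 2)) * cis (inner (\<omega>' + \<omega> / 2) z))"
    unfolding cis_conv_exp by blast
  then have l2: "lam\<^sub>2 z = (\<Sum>\<omega>' \<in> dual_lattice_circle \<Gamma> (\<omega> / 2) \<mu>.
         - (1 / of_real \<mu> * a \<omega>' * cnj (\<omega>' + \<omega> / 2)) * cis (inner (\<omega>' + \<omega> / 2) z))" for z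
    by (simp add: sum_negf)
  note sol = solution_of_exponential_sum[OF assms(1,2) refl l1 l2]
  \<comment> \<open>Translation multiplies both components by the same character value, which is 1
    or -1, and the quadratic form does not see a common sign.\<close>
  have "df_form lam (z + \<gamma>) d = df_form lam z d" if "\<gamma> \<in> \<Gamma>" for \<gamma> z d
    using sol(2,3)[OF that, of z] cis_half_dual_lattice[OF \<omega> that]
      df_form_eq_iff[of lam lam\<^sub>1 lam\<^sub>2 "z + \<gamma>" z, OF assms(3)] by auto
  then show ?L
    using sol(1) unfolding doubly_periodic_form_def by blast
qed

end
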